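(* If $\mathcal V$ is a large category with a strict initial object $0$, then the category $\mathcal V\text{-}\mathbf{Gph}$ of small $\mathcal V$-graphs is extensive.
   Context: Sizes: universes $\mathcal U_1\in\mathcal U_2$ are fixed; "small"/"large" means being an element of $\mathcal U_1$/$\mathcal U_2$. An initial object $0$ is strict if every morphism with codomain $0$ is an isomorphism. A large category $\mathcal V$ is extensive if it has all small coproducts and for every small set $I$ and every family $(X_i)_{i\in I}$ of objects of $\mathcal V$ the functor $\prod_{i\in I}(\mathcal V/X_i)\to\mathcal V/\coprod_{i\in I}X_i$, $(f_i\colon A_i\to X_i)_i\mapsto\coprod_i f_i$, is an equivalence of categories. A small $\mathcal V$-graph $G$ consists of a small set $\mathrm{ob}(G)$ and, for each $x,y\in\mathrm{ob}(G)$, an object $G(x,y)\in\mathcal V$. A morphism $G\to G'$ is a function $f\colon\mathrm{ob}(G)\to\mathrm{ob}(G')$ with morphisms $f_{x,y}\colon G(x,y)\to G'(fx,fy)$ in $\mathcal V$ for all $x,y$. $\mathcal V\text{-}\mathbf{Gph}$ is the category of small $\mathcal V$-graphs. *)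

theory Defs
  imports "HOL-Library.FuncSet"
begin

section \<open>Sets and universes\<close>

text \<open>
  A type of class \<open>set_domain\<close> plays the role of the ambient set theory: its elements are the sets,
  and \<open>elts x\<close> is the collection of members of \<open>x\<close>. Pairing, power set and replacement are not
  required of the whole type; below they are only used inside the given universes. Separation is
  stated in its second-order form, for arbitrary HOL subsets.
\<close>

class set_domain =
  fixes elts :: "'a \<Rightarrow> 'a set"
  assumes extensionality: "inj elts"
    and foundation: "wf {(y, x). y \<in> elts x}"
    and separation: "S \<subseteq> elts x \<Longrightarrow> S \<in> range elts"

text \<open>
  Neither non-emptiness nor the presence of an infinite set is demanded of a universe, so both
  common conventions are covered.
\<close>

definition universe :: "'v::set_domain \<Rightarrow> bool" where
  "universe U \<longleftrightarrow>
     (\<forall>x\<in>elts U. elts x \<subseteq> elts U) \<and>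
     (\<forall>x\<in>elts U. \<forall>y\<in>elts U. \<exists>z\<in>elts U. elts z = {x, y}) \<and>
     (\<forall>x\<in>elts U. \<exists>z\<in>elts U. elts z = {y. elts y \<subseteq> elts x}) \<and>
     (\<forall>x\<in>elts U. \<forall>f. f ` elts x \<subseteq> elts U \<longrightarrow> (\<exists>z\<in>elts U. elts z = (\<Union>y\<in>elts x. elts (f y))))"

text \<open>
  A HOL set of arbitrary type is not literally a member of \<open>U\<close>; it counts as a \<open>U\<close>-set if it is in
  bijection with a member of \<open>U\<close>.
\<close>

definition sized :: "'v::set_domain \<Rightarrow> 'a set \<Rightarrow> bool" where
  "sized U S \<longleftrightarrow> (\<exists>x\<in>elts U. \<exists>f. bij_betw f (elts x) S)"


section \<open>Categories\<close>

text \<open>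
  Hom-sets need not be disjoint, so composition takes the three objects as arguments:
  \<open>Cmp C x y z g f\<close> is the composite of \<open>f : x \<rightarrow> y\<close> followed by \<open>g : y \<rightarrow> z\<close>.
\<close>

record ('o, 'a) cat =
  Obj :: "'o set"
  Hom :: "'o \<Rightarrow> 'o \<Rightarrow> 'a set"
  Ident :: "'o \<Rightarrow> 'a"
  Cmp :: "'o \<Rightarrow> 'o \<Rightarrow> 'o \<Rightarrow> 'a \<Rightarrow> 'a \<Rightarrow> 'a"

locale category =
  fixes C :: "('o, 'a) cat"
  assumes Ident_in_Hom: "x \<in> Obj C \<Longrightarrow> Ident C x \<in> Hom C x x"
    and Cmp_in_Hom: "\<lbrakk>x \<in> Obj C; y \<in> Obj C; z \<in> Obj C; f \<in> Hom C x y; g \<in> Hom C y z\<rbrakk>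
      \<Longrightarrow> Cmp C x y z g f \<in> Hom C x z"
    and Cmp_Ident_right: "\<lbrakk>x \<in> Obj C; y \<in> Obj C; f \<in> Hom C x y\<rbrakk>
      \<Longrightarrow> Cmp C x x y f (Ident C x) = f"
    and Cmp_Ident_left: "\<lbrakk>x \<in> Obj C; y \<in> Obj C; f \<in> Hom C x y\<rbrakk>
      \<Longrightarrow> Cmp C x y y (Ident C y) f = f"
    and Cmp_assoc: "\<lbrakk>w \<in> Obj C; x \<in> Obj C; y \<in> Obj C; z \<in> Obj C;
        f \<in> Hom C w x; g \<in> Hom C x y; h \<in> Hom C y z\<rbrakk>
      \<Longrightarrow> Cmp C w y z h (Cmp C w x y g f) = Cmp C w x z (Cmp C x y z h g) f"

definition large_category :: "'v::set_domain \<Rightarrow> ('o, 'a) cat \<Rightarrow> bool" where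
  "large_category U2 C \<longleftrightarrow>
     category C \<and> sized U2 (Obj C) \<and> (\<forall>x\<in>Obj C. \<forall>y\<in>Obj C. sized U2 (Hom C x y))"

definition is_iso :: "('o, 'a) cat \<Rightarrow> 'o \<Rightarrow> 'o \<Rightarrow> 'a \<Rightarrow> bool" where
  "is_iso C x y f \<longleftrightarrow> f \<in> Hom C x y \<and>
     (\<exists>g\<in>Hom C y x. Cmp C x y x g f = Ident C x \<and> Cmp C y x y f g = Ident C y)"

definition initial_object :: "('o, 'a) cat \<Rightarrow> 'o \<Rightarrow> bool" where
  "initial_object C z \<longleftrightarrow> z \<in> Obj C \<and> (\<forall>x\<in>Obj C. \<exists>!f. f \<in> Hom C z x)"

definition strict_initial_object :: "('o, 'a) cat \<Rightarrow> 'o \<Rightarrow> bool" where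
  "strict_initial_object C z \<longleftrightarrow>
     initial_object C z \<and> (\<forall>x\<in>Obj C. \<forall>f\<in>Hom C x z. is_iso C x z f)"

definition slice :: "('o, 'a) cat \<Rightarrow> 'o \<Rightarrow> ('o \<times> 'a, 'a) cat" where
  "slice C X = \<lparr>
     Obj = {(A, f). A \<in> Obj C \<and> f \<in> Hom C A X},
     Hom = (\<lambda>(A, f) (B, g). {h \<in> Hom C A B. Cmp C A B X g h = f}),
     Ident = (\<lambda>(A, f). Ident C A),
     Cmp = (\<lambda>(A, f) (B, g) (D, h). Cmp C A B D)\<rparr>"

definition product_category ::
  "'i set \<Rightarrow> ('i \<Rightarrow> ('o, 'a) cat) \<Rightarrow> ('i \<Rightarrow> 'o, 'i \<Rightarrow> 'a) cat" where
  "product_category I K = \<lparr>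
     Obj = (\<Pi>\<^sub>E i\<in>I. Obj (K i)),
     Hom = (\<lambda>x y. \<Pi>\<^sub>E i\<in>I. Hom (K i) (x i) (y i)),
     Ident = (\<lambda>x. \<lambda>i\<in>I. Ident (K i) (x i)),
     Cmp = (\<lambda>x y z g f. \<lambda>i\<in>I. Cmp (K i) (x i) (y i) (z i) (g i) (f i))\<rparr>"


section \<open>Functors and equivalences\<close>

record ('o, 'a, 'p, 'b) fctr =
  omap :: "'o \<Rightarrow> 'p"
  amap :: "'o \<Rightarrow> 'o \<Rightarrow> 'a \<Rightarrow> 'b"

definition is_functor :: "('o, 'a) cat \<Rightarrow> ('p, 'b) cat \<Rightarrow> ('o, 'a, 'p, 'b) fctr \<Rightarrow> bool" where
  "is_functor C D F \<longleftrightarrow>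
     (\<forall>x\<in>Obj C. omap F x \<in> Obj D) \<and>
     (\<forall>x\<in>Obj C. \<forall>y\<in>Obj C. \<forall>f\<in>Hom C x y. amap F x y f \<in> Hom D (omap F x) (omap F y)) \<and>
     (\<forall>x\<in>Obj C. amap F x x (Ident C x) = Ident D (omap F x)) \<and>
     (\<forall>x\<in>Obj C. \<forall>y\<in>Obj C. \<forall>z\<in>Obj C. \<forall>f\<in>Hom C x y. \<forall>g\<in>Hom C y z.
        amap F x z (Cmp C x y z g f) =
        Cmp D (omap F x) (omap F y) (omap F z) (amap F y z g) (amap F x y f))"

definition id_functor :: "('o, 'a, 'o, 'a) fctr" where
  "id_functor = \<lparr>omap = (\<lambda>x. x), amap = (\<lambda>x y f. f)\<rparr>"

definition comp_functor ::
  "('p, 'b, 'q, 'c) fctr \<Rightarrow> ('o, 'a, 'p, 'b) fctr \<Rightarrow> ('o, 'a, 'q, 'c) fctr" where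
  "comp_functor G F = \<lparr>
     omap = (\<lambda>x. omap G (omap F x)),
     amap = (\<lambda>x y f. amap G (omap F x) (omap F y) (amap F x y f))\<rparr>"

definition natural_iso ::
  "('o, 'a) cat \<Rightarrow> ('p, 'b) cat \<Rightarrow> ('o, 'a, 'p, 'b) fctr \<Rightarrow> ('o, 'a, 'p, 'b) fctr
   \<Rightarrow> ('o \<Rightarrow> 'b) \<Rightarrow> bool" where
  "natural_iso C D F G \<eta> \<longleftrightarrow>
     (\<forall>x\<in>Obj C. is_iso D (omap F x) (omap G x) (\<eta> x)) \<and>
     (\<forall>x\<in>Obj C. \<forall>y\<in>Obj C. \<forall>f\<in>Hom C x y.
        Cmp D (omap F x) (omap F y) (omap G y) (\<eta> y) (amap F x y f) =
        Cmp D (omap F x) (omap G x) (omap G y) (amap G x y f) (\<eta> x))"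

definition is_equivalence :: "('o, 'a) cat \<Rightarrow> ('p, 'b) cat \<Rightarrow> ('o, 'a, 'p, 'b) fctr \<Rightarrow> bool" where
  "is_equivalence C D F \<longleftrightarrow> is_functor C D F \<and>
     (\<exists>G. is_functor D C G \<and>
        (\<exists>\<eta>. natural_iso C C id_functor (comp_functor G F) \<eta>) \<and>
        (\<exists>\<epsilon>. natural_iso D D (comp_functor F G) id_functor \<epsilon>))"


section \<open>Coproducts and extensive categories\<close>

text \<open>A coproduct is a pair \<open>(P, \<iota>)\<close> of an object and the family of its injections.\<close>

definition is_coproduct ::
  "('o, 'a) cat \<Rightarrow> 'i set \<Rightarrow> ('i \<Rightarrow> 'o) \<Rightarrow> 'o \<times> ('i \<Rightarrow> 'a) \<Rightarrow> bool" where
  "is_coproduct C I A = (\<lambda>(P, \<iota>).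
     P \<in> Obj C \<and> (\<forall>i\<in>I. \<iota> i \<in> Hom C (A i) P) \<and>
     (\<forall>Z\<in>Obj C. \<forall>g\<in>(\<Pi> i\<in>I. Hom C (A i) Z).
        \<exists>!u. u \<in> Hom C P Z \<and> (\<forall>i\<in>I. Cmp C (A i) P Z u (\<iota> i) = g i)))"

text \<open>
  The arrow between the chosen coproducts \<open>(P, \<iota>)\<close> of \<open>A\<close> and \<open>(Q, \<kappa>)\<close> of \<open>B\<close> induced by a family
  \<open>f i : A i \<rightarrow> B i\<close>.
\<close>

definition coproduct_arrow ::
  "('o, 'a) cat \<Rightarrow> 'i set \<Rightarrow> ('i \<Rightarrow> 'o) \<Rightarrow> 'o \<times> ('i \<Rightarrow> 'a) \<Rightarrow> ('i \<Rightarrow> 'o) \<Rightarrow> 'o \<times> ('i \<Rightarrow> 'a)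
   \<Rightarrow> ('i \<Rightarrow> 'a) \<Rightarrow> 'a" where
  "coproduct_arrow C I A = (\<lambda>(P, \<iota>) B (Q, \<kappa>) f.
     (THE u. u \<in> Hom C P Q \<and>
        (\<forall>i\<in>I. Cmp C (A i) P Q u (\<iota> i) = Cmp C (A i) (B i) Q (\<kappa> i) (f i))))"

definition coproduct_choice ::
  "('o, 'a) cat \<Rightarrow> 'i set \<Rightarrow> (('i \<Rightarrow> 'o) \<Rightarrow> 'o \<times> ('i \<Rightarrow> 'a)) \<Rightarrow> bool" where
  "coproduct_choice C I S \<longleftrightarrow> (\<forall>A\<in>I \<rightarrow>\<^sub>E Obj C. is_coproduct C I A (S A))"

text \<open>
  The functor sending a family \<open>f i : A i \<rightarrow> X i\<close> to its coproduct, formed with the chosen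
  coproducts \<open>S\<close>.
\<close>

definition coproduct_functor ::
  "('o, 'a) cat \<Rightarrow> 'i set \<Rightarrow> (('i \<Rightarrow> 'o) \<Rightarrow> 'o \<times> ('i \<Rightarrow> 'a)) \<Rightarrow> ('i \<Rightarrow> 'o)
   \<Rightarrow> ('i \<Rightarrow> 'o \<times> 'a, 'i \<Rightarrow> 'a, 'o \<times> 'a, 'a) fctr" where
  "coproduct_functor C I S X = \<lparr>
     omap = (\<lambda>p. let A = (\<lambda>i\<in>I. fst (p i)) in
       (fst (S A), coproduct_arrow C I A (S A) X (S X) (\<lambda>i. snd (p i)))),
     amap = (\<lambda>p q h. let A = (\<lambda>i\<in>I. fst (p i)); B = (\<lambda>i\<in>I. fst (q i)) in
       coproduct_arrow C I A (S A) B (S B) h)\<rparr>"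

text \<open>
  Small index sets are the members of \<open>U1\<close>. The functor depends on a choice of coproducts, and the
  equivalence is required for every choice.
\<close>

definition extensive :: "'v::set_domain \<Rightarrow> 'v \<Rightarrow> ('o, 'a) cat \<Rightarrow> bool" where
  "extensive U1 U2 C \<longleftrightarrow> large_category U2 C \<and>
     (\<forall>J\<in>elts U1. \<forall>X\<in>elts J \<rightarrow>\<^sub>E Obj C. \<exists>p. is_coproduct C (elts J) X p) \<and>
     (\<forall>J\<in>elts U1. \<forall>S. coproduct_choice C (elts J) S \<longrightarrow>
        (\<forall>X\<in>elts J \<rightarrow>\<^sub>E Obj C.
           is_equivalence (product_category (elts J) (\<lambda>i. slice C (X i)))
             (slice C (fst (S X))) (coproduct_functor C (elts J) S X)))"


section \<open>Enriched graphs\<close>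

record ('v, 'o) vgraph =
  verts :: 'v
  edge :: "'v \<Rightarrow> 'v \<Rightarrow> 'o"

definition small_vgraphs :: "'v::set_domain \<Rightarrow> ('o, 'a) cat \<Rightarrow> ('v, 'o) vgraph set" where
  "small_vgraphs U1 V = {G. verts G \<in> elts U1 \<and>
     edge G \<in> elts (verts G) \<rightarrow>\<^sub>E elts (verts G) \<rightarrow>\<^sub>E Obj V}"

definition vgraph_hom ::
  "('o, 'a) cat \<Rightarrow> ('v::set_domain, 'o) vgraph \<Rightarrow> ('v, 'o) vgraph
   \<Rightarrow> (('v \<Rightarrow> 'v) \<times> ('v \<Rightarrow> 'v \<Rightarrow> 'a)) set" where
  "vgraph_hom V G H = {(f, \<phi>). f \<in> elts (verts G) \<rightarrow>\<^sub>E elts (verts H) \<and>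
     \<phi> \<in> (\<Pi>\<^sub>E x\<in>elts (verts G). \<Pi>\<^sub>E y\<in>elts (verts G). Hom V (edge G x y) (edge H (f x) (f y)))}"

definition Gph ::
  "'v::set_domain \<Rightarrow> ('o, 'a) cat
   \<Rightarrow> (('v, 'o) vgraph, ('v \<Rightarrow> 'v) \<times> ('v \<Rightarrow> 'v \<Rightarrow> 'a)) cat" where
  "Gph U1 V = \<lparr>
     Obj = small_vgraphs U1 V,
     Hom = vgraph_hom V,
     Ident = (\<lambda>G. (\<lambda>x\<in>elts (verts G). x,
       \<lambda>x\<in>elts (verts G). \<lambda>y\<in>elts (verts G). Ident V (edge G x y))),
     Cmp = (\<lambda>G H K (g, \<psi>) (f, \<phi>). (\<lambda>x\<in>elts (verts G). g (f x),
       \<lambda>x\<in>elts (verts G). \<lambda>y\<in>elts (verts G).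
         Cmp V (edge G x y) (edge H (f x) (f y)) (edge K (g (f x)) (g (f y)))
           (\<psi> (f x) (f y)) (\<phi> x y)))\<rparr>"

end

theory Submission
  imports Defs
begin

text \<open>
  In any category with chosen coproducts, the coproduct functor is fully faithful as soon as the
  squares formed by the coprojections and a map \<open>u\<close> of coproducts induced by a family \<open>f i\<close> are
  pullbacks, and essentially surjective as soon as every map into a coproduct of the \<open>X i\<close> exhibits
  its domain as a coproduct lying componentwise over the \<open>X i\<close>. In graphs over \<open>V\<close> the
  coproducts are exactly the disjoint unions in which an edge object between different components is
  initial. Hence a map into a summand can be detected on vertices, which gives the pullbacks, and the
  preimages of the components of a coproduct decompose the domain of any map \<open>Y \<rightarrow> Q\<close>: between
  different preimages an edge object of \<open>Y\<close> maps to an initial object, so it is initial by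
  strictness.
\<close>

section \<open>Closure properties of universes\<close>

text \<open>Extensivity quantifies over all choices of coproducts, so one explicit disjoint union is
  not enough: every coproduct cocone has to be shown to have the disjoint form. For this reason an
  edge object between components is only asked to be initial rather than equal to the given
  \<open>z\<close>; this form survives transport along isomorphisms and also fits the decomposition
  of an arbitrary graph over a coproduct. As strictness is postulated at \<open>z\<close> alone, it
  is first passed on to every initial object. The category \<open>V\<close> may lack pullbacks, so
  the cartesian squares cannot be computed edge by edge. They come from the coprojections being
  injective on vertices and invertible on edges: a map factors through such an embedding once its
  vertices do, and its edges are recovered by inverting. The tagged pairs forming a disjoint union
  are HOL pairs, not elements of the ambient sets. The notion \<open>sized\<close> bridges this gap:
  the vertex set is a member of the universe in bijection with the dependent sum. The same bounds,
  applied to the larger universe, show that graphs form a large category.\<close>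

lemma universeD:
  assumes "universe U" and "x \<in> elts U"
  shows universe_trans: "elts x \<subseteq> elts U"
    and universe_pair: "y \<in> elts U \<Longrightarrow> \<exists>z\<in>elts U. elts z = {x, y}"
    and universe_power: "\<exists>z\<in>elts U. elts z = {y. elts y \<subseteq> elts x}"
    and universe_Union: "f ` elts x \<subseteq> elts U \<Longrightarrow> \<exists>z\<in>elts U. elts z = (\<Union>y\<in>elts x. elts (f y))"
proof -
  note U = assms(1)[unfolded universe_def]
  show "elts x \<subseteq> elts U" using U assms(2) by (elim conjE) (erule (1) bspec)
  show "y \<in> elts U \<Longrightarrow> \<exists>z\<in>elts U. elts z = {x, y}"
    using U assms(2) by (elim conjE) (drule (1) bspec, erule (1) bspec)
  show "\<exists>z\<in>elts U. elts z = {y. elts y \<subseteq> elts x}" using U assms(2) by (elim conjE) (erule (1) bspec)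
  show "f ` elts x \<subseteq> elts U \<Longrightarrow> \<exists>z\<in>elts U. elts z = (\<Union>y\<in>elts x. elts (f y))"
    using U assms(2) by (elim conjE) simp
qed

text \<open>Separation yields a set of the ambient type only; it lies in \<open>U\<close> because it
  is a member of the power set of \<open>x\<close> and \<open>U\<close> is transitive.\<close>

lemma universe_subset:
  assumes U: "universe U" and x: "x \<in> elts U" and S: "S \<subseteq> elts x"
  obtains w where "w \<in> elts U" "elts w = S"
proof -
  obtain w where w: "elts w = S" using separation[OF S] by (metis imageE)
  obtain p where p: "p \<in> elts U" "elts p = {y. elts y \<subseteq> elts x}"
    using universe_power[OF U x] by blast
  have "w \<in> elts p" using w S p by auto
  then have "w \<in> elts U" using universe_trans[OF U p(1)] by blast
  then show ?thesis using w that by blast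
qed

text \<open>An injection turns \<open>S\<close> into a subset of a member of \<open>U\<close>, and
  such subsets are members again. The later size bounds thus reduce to finding an injection into
  something already bounded.\<close>

lemma sized_inj_on:
  assumes U: "universe U" and T: "sized U T" and f: "inj_on f S" "f ` S \<subseteq> T"
  shows "sized U S"
proof -
  obtain x g where x: "x \<in> elts U" and g: "bij_betw g (elts x) T"
    using T unfolding sized_def by blast
  let ?h = "inv_into (elts x) g \<circ> f"
  have g': "inj_on (inv_into (elts x) g) T" "inv_into (elts x) g ` T = elts x"
    using bij_betw_inv_into[OF g] bij_betw_imp_inj_on bij_betw_imp_surj_on by metis+
  have inj: "inj_on ?h S"
    using f g'(1) by (intro comp_inj_on) (auto intro: inj_on_subset)
  have "?h ` S \<subseteq> elts x"
    using f(2) g'(2) by auto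
  then obtain w where w: "w \<in> elts U" "elts w = ?h ` S"
    using universe_subset[OF U x] by blast
  have "bij_betw (inv_into S ?h) (elts w) S"
    using inj w(2) by (metis bij_betw_inv_into inj_on_imp_bij_betw)
  then show ?thesis using w(1) unfolding sized_def by blast
qed

lemma sized_subset: "universe U \<Longrightarrow> sized U T \<Longrightarrow> S \<subseteq> T \<Longrightarrow> sized U S"
  by (rule sized_inj_on[where f = "\<lambda>x. x"]) auto

lemma sized_elts: "x \<in> elts U \<Longrightarrow> sized U (elts x)"
  unfolding sized_def using bij_betw_id by blast

text \<open>The map \<open>elts\<close> identifies the members of the internal power set with the
  HOL subsets of \<open>elts x\<close>: it is injective by extensionality and surjective by
  separation.\<close>

lemma sized_Pow:
  assumes U: "universe U" and T: "sized U T"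
  shows "sized U (Pow T)"
proof -
  obtain x g where x: "x \<in> elts U" and g: "bij_betw g (elts x) T"
    using T unfolding sized_def by blast
  obtain p where p: "p \<in> elts U" "elts p = {y. elts y \<subseteq> elts x}"
    using universe_power[OF U x] by blast
  have "Pow (elts x) \<subseteq> elts ` elts p"
  proof
    fix S assume S: "S \<in> Pow (elts x)"
    then obtain w where "elts w = S" using separation[of S x] by (metis PowD imageE)
    then show "S \<in> elts ` elts p" using S p(2) by blast
  qed
  then have "elts ` elts p = Pow (elts x)" using p(2) by blast
  then have "bij_betw elts (elts p) (Pow (elts x))"
    using extensionality unfolding bij_betw_def by (metis inj_on_subset subset_UNIV)
  then have "bij_betw (image g \<circ> elts) (elts p) (Pow T)"
    using bij_betw_Pow[OF g] by (rule bij_betw_trans)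
  then show ?thesis using p(1) unfolding sized_def by blast
qed

lemma universe_Un:
  assumes U: "universe U" and x: "x \<in> elts U" and y: "y \<in> elts U"
  obtains w where "w \<in> elts U" "elts w = elts x \<union> elts y"
proof -
  obtain p where p: "p \<in> elts U" "elts p = {x, y}"
    using universe_pair[OF U x y] by blast
  have "(\<lambda>a. a) ` elts p \<subseteq> elts U" using p x y by auto
  then obtain w where "w \<in> elts U" "elts w = (\<Union>a\<in>elts p. elts a)"
    using universe_Union[OF U p(1), of "\<lambda>a. a"] by blast
  then show ?thesis using p that by auto
qed

lemma sized_Times:
  assumes U: "universe U" and S: "sized U S" and T: "sized U T"
  shows "sized U (S \<times> T)"
proof -
  obtain x f where x: "x \<in> elts U" and f: "bij_betw f (elts x) S"
    using S unfolding sized_def by blast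
  obtain y g where y: "y \<in> elts U" and g: "bij_betw g (elts y) T"
    using T unfolding sized_def by blast
  obtain w where w: "w \<in> elts U" "elts w = elts x \<union> elts y"
    using universe_Un[OF U x y] .
  define f' where "f' = inv_into (elts x) f"
  define g' where "g' = inv_into (elts y) g"
  have f': "inj_on f' S" "f' ` S \<subseteq> elts x"
    using bij_betw_imp_inj_on[OF bij_betw_inv_into[OF f]] bij_betw_imp_surj_on[OF bij_betw_inv_into[OF f]]
    unfolding f'_def by auto
  have g': "inj_on g' T" "g' ` T \<subseteq> elts y"
    using bij_betw_imp_inj_on[OF bij_betw_inv_into[OF g]] bij_betw_imp_surj_on[OF bij_betw_inv_into[OF g]]
    unfolding g'_def by auto
  \<comment> \<open>Kuratowski pairs of the codes of \<open>a\<close> and \<open>b\<close>, formed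
    as HOL sets, so that the product sits in a double power set of the union of the two coding
    sets.\<close>
  let ?k = "\<lambda>(a, b). {{f' a}, {f' a, g' b}}"
  have "inj_on ?k (S \<times> T)"
  proof (rule inj_onI, clarify)
    fix a b c d
    assume *: "a \<in> S" "b \<in> T" "c \<in> S" "d \<in> T"
      and eq: "{{f' a}, {f' a, g' b}} = {{f' c}, {f' c, g' d}}"
    from eq have "f' a = f' c \<and> g' b = g' d" by (auto simp: doubleton_eq_iff)
    then show "a = c \<and> b = d" using * f'(1) g'(1) by (auto dest: inj_onD)
  qed
  moreover have "?k ` (S \<times> T) \<subseteq> Pow (Pow (elts w))"
    using f'(2) g'(2) w by auto
  ultimately show ?thesis
    by (rule sized_inj_on[OF U sized_Pow[OF U sized_Pow[OF U sized_elts[OF w(1)]]]])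
qed

text \<open>Choosing a code in \<open>U\<close> for every fibre, the union of these codes is again a
  member of \<open>U\<close>; the dependent sum then embeds into an ordinary product.\<close>

lemma sized_Sigma:
  assumes U: "universe U" and S: "sized U S" and T: "\<And>i. i \<in> S \<Longrightarrow> sized U (T i)"
  shows "sized U (Sigma S T)"
proof -
  obtain x b where x: "x \<in> elts U" and b: "bij_betw b (elts x) S"
    using S unfolding sized_def by blast
  have "\<forall>i\<in>S. \<exists>t g. t \<in> elts U \<and> bij_betw g (elts t) (T i)"
    using T unfolding sized_def by blast
  then obtain t g where tg: "\<And>i. i \<in> S \<Longrightarrow> t i \<in> elts U \<and> bij_betw (g i) (elts (t i)) (T i)"
    by metis
  \<comment> \<open>The union axiom wants a family indexed by a member of \<open>U\<close>, so the
    fibre codes are reindexed along \<open>b\<close>.\<close>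
  have "(\<lambda>y. t (b y)) ` elts x \<subseteq> elts U"
    using tg b by (auto simp: bij_betw_def)
  then obtain w where w: "w \<in> elts U" "elts w = (\<Union>y\<in>elts x. elts (t (b y)))"
    using universe_Union[OF U x, of "\<lambda>y. t (b y)"] by blast
  have w': "elts (t i) \<subseteq> elts w" if "i \<in> S" for i
    using that b unfolding w(2) bij_betw_def by fastforce
  let ?g' = "\<lambda>i. inv_into (elts (t i)) (g i)"
  have g': "inj_on (?g' i) (T i)" "?g' i ` T i = elts (t i)" if "i \<in> S" for i
    using tg[OF that] bij_betw_inv_into bij_betw_imp_inj_on bij_betw_imp_surj_on by metis+
  let ?k = "\<lambda>(i, a). (i, ?g' i a)"
  have "inj_on ?k (Sigma S T)"
    using g'(1) by (auto simp: inj_on_def)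
  moreover have "?k ` Sigma S T \<subseteq> S \<times> elts w"
    using g'(2) w' by fastforce
  ultimately show ?thesis
    by (rule sized_inj_on[OF U sized_Times[OF U S sized_elts[OF w(1)]]])
qed

text \<open>A function is sent to its graph, a subset of the dependent sum. This is injective
  because elements of \<open>PiE\<close> are fixed outside \<open>S\<close>.\<close>

lemma sized_PiE:
  assumes U: "universe U" and S: "sized U S" and T: "\<And>i. i \<in> S \<Longrightarrow> sized U (T i)"
  shows "sized U (PiE S T)"
proof -
  let ?k = "\<lambda>f. (\<lambda>i. (i, f i)) ` S"
  have "inj_on ?k (PiE S T)"
  proof (rule inj_onI)
    fix f g assume f: "f \<in> PiE S T" and g: "g \<in> PiE S T" and eq: "?k f = ?k g"
    have "f i = g i" if "i \<in> S" for i
    proof -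
      have "(i, f i) \<in> ?k g" using that eq by blast
      then show ?thesis by auto
    qed
    then show "f = g" using f g by (rule PiE_ext[rotated -1]) 
  qed
  moreover have "?k ` PiE S T \<subseteq> Pow (Sigma S T)" by auto
  ultimately show ?thesis
    by (rule sized_inj_on[OF U sized_Pow[OF U sized_Sigma[OF U S]], rotated -2]) (rule T)
qed

section \<open>Equivalences and coproducts\<close>

context category
begin

lemma comp_in: "\<lbrakk>f \<in> Hom C x y; g \<in> Hom C y z; x \<in> Obj C; y \<in> Obj C; z \<in> Obj C\<rbrakk>
    \<Longrightarrow> Cmp C x y z g f \<in> Hom C x z"
  by (rule Cmp_in_Hom)

lemma is_isoE:
  assumes "is_iso C x y f"
  obtains g where "f \<in> Hom C x y" "g \<in> Hom C y x"
    "Cmp C x y x g f = Ident C x" "Cmp C y x y f g = Ident C y"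
  using assms unfolding is_iso_def by blast

text \<open>Stated for a one-sided inverse, so that it applies to an isomorphism and, with
  \<open>f\<close> and \<open>g\<close> exchanged, to its inverse.\<close>

lemma cancel_left:
  assumes "Cmp C x y x g f = Ident C x" "f \<in> Hom C x y" "g \<in> Hom C y x" "h \<in> Hom C w x"
    "w \<in> Obj C" "x \<in> Obj C" "y \<in> Obj C"
  shows "Cmp C w y x g (Cmp C w x y f h) = h"
  using assms Cmp_assoc[of w x y x h f g] Cmp_Ident_left by simp

lemma cancel_right:
  assumes "Cmp C x y x g f = Ident C x" "f \<in> Hom C x y" "g \<in> Hom C y x" "h \<in> Hom C x w"
    "w \<in> Obj C" "x \<in> Obj C" "y \<in> Obj C"
  shows "Cmp C x y w (Cmp C y x w h g) f = h"
  using assms Cmp_assoc[of x y x w f g h] Cmp_Ident_right by simp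

lemma iso_cancel_left:
  assumes f: "is_iso C x y f" and h: "h \<in> Hom C w x" "k \<in> Hom C w x"
    and O: "w \<in> Obj C" "x \<in> Obj C" "y \<in> Obj C"
    and eq: "Cmp C w x y f h = Cmp C w x y f k"
  shows "h = k"
proof -
  obtain g where g: "f \<in> Hom C x y" "g \<in> Hom C y x" "Cmp C x y x g f = Ident C x"
    using f by (rule is_isoE)
  show ?thesis using cancel_left[OF g(3,1,2) h(1) O] cancel_left[OF g(3,1,2) h(2) O]
    unfolding eq by (rule trans[OF sym])
qed

lemma iso_cancel_right:
  assumes f: "is_iso C x y f" and h: "h \<in> Hom C y w" "k \<in> Hom C y w"
    and O: "w \<in> Obj C" "x \<in> Obj C" "y \<in> Obj C"
    and eq: "Cmp C x y w h f = Cmp C x y w k f"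
  shows "h = k"
proof -
  obtain g where g: "f \<in> Hom C x y" "g \<in> Hom C y x" "Cmp C y x y f g = Ident C y"
    using f by (rule is_isoE)
  show ?thesis
    using cancel_right[OF g(3,2,1) h(1) O(1,3,2)] cancel_right[OF g(3,2,1) h(2) O(1,3,2)]
    unfolding eq by (rule trans[OF sym])
qed

lemma iso_comp:
  assumes f: "is_iso C x y f" and g: "is_iso C y z g"
    and [simp]: "x \<in> Obj C" "y \<in> Obj C" "z \<in> Obj C"
  shows "is_iso C x z (Cmp C x y z g f)"
proof -
  obtain f' where f': "f \<in> Hom C x y" "f' \<in> Hom C y x"
    "Cmp C x y x f' f = Ident C x" "Cmp C y x y f f' = Ident C y"
    using f by (rule is_isoE)
  obtain g' where g': "g \<in> Hom C y z" "g' \<in> Hom C z y"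
    "Cmp C y z y g' g = Ident C y" "Cmp C z y z g g' = Ident C z"
    using g by (rule is_isoE)
  note [simp] = f' g' comp_in
  have "Cmp C x z x (Cmp C z y x f' g') (Cmp C x y z g f)
      = Cmp C x y x f' (Cmp C x z y g' (Cmp C x y z g f))"
    by (simp add: Cmp_assoc[of x z y x "Cmp C x y z g f" g' f'])
  also have "\<dots> = Ident C x" by (simp add: cancel_left)
  finally have 1: "Cmp C x z x (Cmp C z y x f' g') (Cmp C x y z g f) = Ident C x" .
  have "Cmp C z x z (Cmp C x y z g f) (Cmp C z y x f' g')
      = Cmp C z y z g (Cmp C z x y f (Cmp C z y x f' g'))"
    by (simp add: Cmp_assoc[of z x y z "Cmp C z y x f' g'" f g])
  also have "\<dots> = Ident C z" by (simp add: cancel_left)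
  finally have 2: "Cmp C z x z (Cmp C x y z g f) (Cmp C z y x f' g') = Ident C z" .
  show ?thesis unfolding is_iso_def using 1 2 by (intro conjI bexI[of _ "Cmp C z y x f' g'"]) auto
qed

lemma initial_object_iso:
  assumes z: "initial_object C z" and f: "is_iso C x z f" and x[simp]: "x \<in> Obj C"
  shows "initial_object C x"
  unfolding initial_object_def
proof (intro conjI ballI x)
  fix w assume w[simp]: "w \<in> Obj C"
  have zO[simp]: "z \<in> Obj C" using z by (simp add: initial_object_def)
  obtain g where fg[simp]: "f \<in> Hom C x z" "g \<in> Hom C z x"
    "Cmp C x z x g f = Ident C x" "Cmp C z x z f g = Ident C z"
    using f by (rule is_isoE)
  obtain k where k[simp]: "k \<in> Hom C z w" and uniq: "\<And>k'. k' \<in> Hom C z w \<Longrightarrow> k' = k"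
    using z unfolding initial_object_def by (meson w)
  show "\<exists>!h. h \<in> Hom C x w"
  proof (rule ex1I[of _ "Cmp C x z w k f"])
    show "Cmp C x z w k f \<in> Hom C x w" by (simp add: comp_in)
    fix h assume h[simp]: "h \<in> Hom C x w"
    have "Cmp C z x w h g = k" by (rule uniq) (simp add: comp_in)
    then show "h = Cmp C x z w k f"
      using cancel_right[of x z g f h w] by simp
  qed
qed

end

section \<open>Coproducts and their comparison\<close>

lemma is_coproductD:
  assumes "is_coproduct C I A (P, \<iota>)"
  shows "P \<in> Obj C" "\<And>i. i \<in> I \<Longrightarrow> \<iota> i \<in> Hom C (A i) P"
    "\<And>Z g. \<lbrakk>Z \<in> Obj C; \<And>i. i \<in> I \<Longrightarrow> g i \<in> Hom C (A i) Z\<rbrakk>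
      \<Longrightarrow> \<exists>!u. u \<in> Hom C P Z \<and> (\<forall>i\<in>I. Cmp C (A i) P Z u (\<iota> i) = g i)"
  using assms unfolding is_coproduct_def by (auto simp: Pi_iff)

context category
begin

text \<open>The coprojections are jointly epic: both arrows solve the universal problem posed by the
  composites of \<open>u\<close>.\<close>

lemma coproduct_eqI:
  assumes "is_coproduct C I A (P, \<iota>)" "Z \<in> Obj C" "A \<in> I \<rightarrow> Obj C" "u \<in> Hom C P Z" "v \<in> Hom C P Z"
    "\<And>i. i \<in> I \<Longrightarrow> Cmp C (A i) P Z u (\<iota> i) = Cmp C (A i) P Z v (\<iota> i)"
  shows "u = v"
proof -
  have "\<exists>!w. w \<in> Hom C P Z \<and> (\<forall>i\<in>I. Cmp C (A i) P Z w (\<iota> i) = Cmp C (A i) P Z u (\<iota> i))"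
    using assms is_coproductD[OF assms(1)] by (intro is_coproductD(3)[OF assms(1)]) (auto intro!: comp_in)
  then show ?thesis using assms by metis
qed

text \<open>The composites of \<open>f i\<close> with \<kappa> i form a cocone on \<open>A\<close>,
  so the definite description in \<open>coproduct_arrow\<close> has exactly one solution.\<close>

lemma coproduct_arrow:
  assumes P: "is_coproduct C I A (P, \<iota>)" and Q: "is_coproduct C I B (Q, \<kappa>)"
    and AB: "A \<in> I \<rightarrow> Obj C" "B \<in> I \<rightarrow> Obj C"
    and f: "\<And>i. i \<in> I \<Longrightarrow> f i \<in> Hom C (A i) (B i)"
  shows "coproduct_arrow C I A (P, \<iota>) B (Q, \<kappa>) f \<in> Hom C P Q"
    and "i \<in> I \<Longrightarrow> Cmp C (A i) P Q (coproduct_arrow C I A (P, \<iota>) B (Q, \<kappa>) f) (\<iota> i)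
      = Cmp C (A i) (B i) Q (\<kappa> i) (f i)"
proof -
  have "\<exists>!u. u \<in> Hom C P Q \<and> (\<forall>i\<in>I. Cmp C (A i) P Q u (\<iota> i) = Cmp C (A i) (B i) Q (\<kappa> i) (f i))"
    using AB f is_coproductD(1,2)[OF Q]
    by (intro is_coproductD(3)[OF P]) (auto intro!: comp_in)
  from theI'[OF this]
  show "coproduct_arrow C I A (P, \<iota>) B (Q, \<kappa>) f \<in> Hom C P Q"
    and "i \<in> I \<Longrightarrow> Cmp C (A i) P Q (coproduct_arrow C I A (P, \<iota>) B (Q, \<kappa>) f) (\<iota> i)
      = Cmp C (A i) (B i) Q (\<kappa> i) (f i)"
    unfolding coproduct_arrow_def by auto
qed

lemma coproduct_arrow_eqI:
  assumes P: "is_coproduct C I A (P, \<iota>)" and Q: "is_coproduct C I B (Q, \<kappa>)"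
    and AB: "A \<in> I \<rightarrow> Obj C" "B \<in> I \<rightarrow> Obj C"
    and f: "\<And>i. i \<in> I \<Longrightarrow> f i \<in> Hom C (A i) (B i)"
    and u: "u \<in> Hom C P Q"
    and eq: "\<And>i. i \<in> I \<Longrightarrow> Cmp C (A i) P Q u (\<iota> i) = Cmp C (A i) (B i) Q (\<kappa> i) (f i)"
  shows "coproduct_arrow C I A (P, \<iota>) B (Q, \<kappa>) f = u"
proof (rule coproduct_eqI[OF P is_coproductD(1)[OF Q] AB(1) _ u])
  show "coproduct_arrow C I A (P, \<iota>) B (Q, \<kappa>) f \<in> Hom C P Q"
    by (rule coproduct_arrow(1)[OF P Q AB f])
  show "Cmp C (A i) P Q (coproduct_arrow C I A (P, \<iota>) B (Q, \<kappa>) f) (\<iota> i) = Cmp C (A i) P Q u (\<iota> i)"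
    if "i \<in> I" for i
    using coproduct_arrow(2)[OF P Q AB f that] eq[OF that] by simp
qed

text \<open>Compatibility with the coprojections is kept in the conclusion, since it determines
  every further composite with \<open>e\<close>, in particular whether \<open>e\<close> lies over a
  given base.\<close>

lemma coproducts_iso:
  assumes P: "is_coproduct C I A (P, \<iota>)" and Q: "is_coproduct C I A (Q, \<kappa>)"
    and A: "A \<in> I \<rightarrow> Obj C"
  obtains e where "is_iso C P Q e" "\<And>i. i \<in> I \<Longrightarrow> Cmp C (A i) P Q e (\<iota> i) = \<kappa> i"
proof -
  note PD = is_coproductD[OF P] and QD = is_coproductD[OF Q]
  obtain e where e: "e \<in> Hom C P Q" "\<And>i. i \<in> I \<Longrightarrow> Cmp C (A i) P Q e (\<iota> i) = \<kappa> i"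
    using PD(3)[of Q \<kappa>] QD by blast
  obtain e' where e': "e' \<in> Hom C Q P" "\<And>i. i \<in> I \<Longrightarrow> Cmp C (A i) Q P e' (\<kappa> i) = \<iota> i"
    using QD(3)[of P \<iota>] PD by blast
  have "Cmp C P Q P e' e = Ident C P"
  proof (rule coproduct_eqI[OF P _ A])
    fix i assume i: "i \<in> I"
    then have "A i \<in> Obj C" using A by auto
    then show "Cmp C (A i) P P (Cmp C P Q P e' e) (\<iota> i) = Cmp C (A i) P P (Ident C P) (\<iota> i)"
      using i e e' PD QD by (simp flip: Cmp_assoc add: Cmp_Ident_left)
  qed (use e e' PD QD in \<open>auto intro!: comp_in Ident_in_Hom\<close>)
  moreover have "Cmp C Q P Q e e' = Ident C Q"
  proof (rule coproduct_eqI[OF Q _ A])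
    fix i assume i: "i \<in> I"
    then have "A i \<in> Obj C" using A by auto
    then show "Cmp C (A i) Q Q (Cmp C Q P Q e e') (\<kappa> i) = Cmp C (A i) Q Q (Ident C Q) (\<kappa> i)"
      using i e e' PD QD by (simp flip: Cmp_assoc add: Cmp_Ident_left)
  qed (use e e' PD QD in \<open>auto intro!: comp_in Ident_in_Hom\<close>)
  ultimately have "is_iso C P Q e" unfolding is_iso_def using e e' by blast
  then show ?thesis using e that by blast
qed

end

section \<open>Slices and products of categories\<close>

lemma category_slice:
  assumes "category C" and X: "X \<in> Obj C"
  shows "category (slice C X)"
proof -
  interpret category C by fact
  show ?thesis
  proof
    fix x y z f g
    assume "x \<in> Obj (slice C X)" "y \<in> Obj (slice C X)" "z \<in> Obj (slice C X)"
      "f \<in> Hom (slice C X) x y" "g \<in> Hom (slice C X) y z"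
    then show "Cmp (slice C X) x y z g f \<in> Hom (slice C X) x z"
      using X by (auto simp: slice_def comp_in Cmp_assoc)
  next
    fix w x y z f g h
    assume "w \<in> Obj (slice C X)" "x \<in> Obj (slice C X)" "y \<in> Obj (slice C X)" "z \<in> Obj (slice C X)"
      "f \<in> Hom (slice C X) w x" "g \<in> Hom (slice C X) x y" "h \<in> Hom (slice C X) y z"
    then show "Cmp (slice C X) w y z h (Cmp (slice C X) w x y g f)
      = Cmp (slice C X) w x z (Cmp (slice C X) x y z h g) f"
      by (auto simp: slice_def Cmp_assoc)
  qed (auto simp: slice_def X Ident_in_Hom Cmp_Ident_left Cmp_Ident_right)
qed

lemma category_product:
  assumes "\<And>i. i \<in> I \<Longrightarrow> category (K i)"
  shows "category (product_category I K)"
proof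
  fix x assume "x \<in> Obj (product_category I K)"
  then show "Ident (product_category I K) x \<in> Hom (product_category I K) x x"
    using assms category.Ident_in_Hom by (fastforce simp: product_category_def PiE_iff)
next
  fix x y z f g
  assume "x \<in> Obj (product_category I K)" "y \<in> Obj (product_category I K)"
    "z \<in> Obj (product_category I K)"
    "f \<in> Hom (product_category I K) x y" "g \<in> Hom (product_category I K) y z"
  then show "Cmp (product_category I K) x y z g f \<in> Hom (product_category I K) x z"
    using assms by (auto simp: product_category_def PiE_iff intro!: category.Cmp_in_Hom)
next
  fix x y f
  assume *: "x \<in> Obj (product_category I K)" "y \<in> Obj (product_category I K)"
    "f \<in> Hom (product_category I K) x y"
  then show "Cmp (product_category I K) x x y f (Ident (product_category I K) x) = f"
    using assms by (intro extensionalityI[of _ I])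
      (auto simp: product_category_def PiE_iff category.Cmp_Ident_right)
  from * show "Cmp (product_category I K) x y y (Ident (product_category I K) y) f = f"
    using assms by (intro extensionalityI[of _ I])
      (auto simp: product_category_def PiE_iff category.Cmp_Ident_left)
next
  fix w x y z f g h
  assume *: "w \<in> Obj (product_category I K)" "x \<in> Obj (product_category I K)"
    "y \<in> Obj (product_category I K)" "z \<in> Obj (product_category I K)"
    "f \<in> Hom (product_category I K) w x" "g \<in> Hom (product_category I K) x y"
    "h \<in> Hom (product_category I K) y z"
  show "Cmp (product_category I K) w y z h (Cmp (product_category I K) w x y g f)
    = Cmp (product_category I K) w x z (Cmp (product_category I K) x y z h g) f"
  proof (rule extensionalityI[of _ I])
    fix i assume i: "i \<in> I"
    interpret category "K i" using assms i .
    show "Cmp (product_category I K) w y z h (Cmp (product_category I K) w x y g f) i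
      = Cmp (product_category I K) w x z (Cmp (product_category I K) x y z h g) f i"
      using * i by (auto simp: product_category_def PiE_iff Cmp_assoc)
  qed (auto simp: product_category_def)
qed

text \<open>The inverse of \<open>e\<close> lies over \<open>X\<close> automatically: composing
  \<open>h e = u\<close> with it on the right leaves \<open>h\<close>.\<close>

lemma is_iso_slice:
  assumes "category C" and e: "is_iso C P Y e" and eq: "Cmp C P Y X h e = u"
    and h: "h \<in> Hom C Y X" and O: "P \<in> Obj C" "Y \<in> Obj C" "X \<in> Obj C"
  shows "is_iso (slice C X) (P, u) (Y, h) e"
proof -
  interpret category C by fact
  obtain g where g: "e \<in> Hom C P Y" "g \<in> Hom C Y P"
    "Cmp C P Y P g e = Ident C P" "Cmp C Y P Y e g = Ident C Y"
    using e by (rule is_isoE)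
  then have "Cmp C Y P X u g = h" using cancel_right[of Y P e g h X] O h eq by simp
  then show ?thesis using g eq unfolding is_iso_def by (auto simp: slice_def)
qed

section \<open>Equivalences from full faithfulness and essential surjectivity\<close>

text \<open>A quasi-inverse is assembled by choice: \<open>c d\<close> is an object with an
  isomorphism \<open>e d\<close> from its image to \<open>d\<close>, and an arrow is conjugated by
  these isomorphisms and then lifted through \<open>F\<close>.\<close>

lemma fully_faithful_surjective_imp_equivalence:
  assumes "category C" and "category D" and F: "is_functor C D F"
    and ff: "\<And>x y. x \<in> Obj C \<Longrightarrow> y \<in> Obj C \<Longrightarrow>
      bij_betw (amap F x y) (Hom C x y) (Hom D (omap F x) (omap F y))"
    and eso: "\<And>d. d \<in> Obj D \<Longrightarrow> \<exists>c\<in>Obj C. \<exists>e. is_iso D (omap F c) d e"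
  shows "is_equivalence C D F"
proof -
  interpret C: category C by fact
  interpret D: category D by fact
  have "\<forall>d\<in>Obj D. \<exists>c e e'. c \<in> Obj C \<and> e \<in> Hom D (omap F c) d \<and> e' \<in> Hom D d (omap F c) \<and>
      Cmp D (omap F c) d (omap F c) e' e = Ident D (omap F c) \<and> Cmp D d (omap F c) d e e' = Ident D d"
    using eso unfolding is_iso_def by blast
  then obtain c e e' where ce: "\<And>d. d \<in> Obj D \<Longrightarrow> c d \<in> Obj C"
    "\<And>d. d \<in> Obj D \<Longrightarrow> e d \<in> Hom D (omap F (c d)) d"
    "\<And>d. d \<in> Obj D \<Longrightarrow> e' d \<in> Hom D d (omap F (c d))"
    "\<And>d. d \<in> Obj D \<Longrightarrow> Cmp D (omap F (c d)) d (omap F (c d)) (e' d) (e d) = Ident D (omap F (c d))"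
    "\<And>d. d \<in> Obj D \<Longrightarrow> Cmp D d (omap F (c d)) d (e d) (e' d) = Ident D d"
    by metis
  have FO: "\<And>x. x \<in> Obj C \<Longrightarrow> omap F x \<in> Obj D"
    and FH: "\<And>x y f. x \<in> Obj C \<Longrightarrow> y \<in> Obj C \<Longrightarrow> f \<in> Hom C x y
      \<Longrightarrow> amap F x y f \<in> Hom D (omap F x) (omap F y)"
    and FI: "\<And>x. x \<in> Obj C \<Longrightarrow> amap F x x (Ident C x) = Ident D (omap F x)"
    and FC: "\<And>x y z f g. x \<in> Obj C \<Longrightarrow> y \<in> Obj C \<Longrightarrow> z \<in> Obj C \<Longrightarrow> f \<in> Hom C x y \<Longrightarrow> g \<in> Hom C y z
      \<Longrightarrow> amap F x z (Cmp C x y z g f)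
        = Cmp D (omap F x) (omap F y) (omap F z) (amap F y z g) (amap F x y f)"
    using F unfolding is_functor_def by auto
  define L where "L x y = inv_into (Hom C x y) (amap F x y)" for x y
  have LH: "L x y g \<in> Hom C x y" and FL: "amap F x y (L x y g) = g"
    if "x \<in> Obj C" "y \<in> Obj C" "g \<in> Hom D (omap F x) (omap F y)" for x y g
    using ff[OF that(1,2)] that(3) unfolding L_def
    by (auto simp: bij_betw_def f_inv_into_f inv_into_into)
  have faithful: "f = g" if "x \<in> Obj C" "y \<in> Obj C" "f \<in> Hom C x y" "g \<in> Hom C x y"
    "amap F x y f = amap F x y g" for x y f g
    using ff[OF that(1,2)] that(3-) by (auto simp: bij_betw_def inj_on_def)
  \<comment> \<open>Conjugation of \<open>g\<close> by the chosen isomorphisms, still in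
    \<open>D\<close>; \<open>L\<close> lifts the result to \<open>C\<close>.\<close>
  define H where "H d d' g = Cmp D (omap F (c d)) d (omap F (c d')) (Cmp D d d' (omap F (c d')) (e' d') g) (e d)"
    for d d' g
  define G where "G = \<lparr>omap = c, amap = (\<lambda>d d' g. L (c d) (c d') (H d d' g))\<rparr>"
  note [simp] = ce FO FH FI FC LH FL D.comp_in C.comp_in D.Ident_in_Hom C.Ident_in_Hom
    D.Cmp_Ident_left D.Cmp_Ident_right C.Cmp_Ident_left C.Cmp_Ident_right
  have H[simp]: "H d d' g \<in> Hom D (omap F (c d)) (omap F (c d'))"
    if "d \<in> Obj D" "d' \<in> Obj D" "g \<in> Hom D d d'" for d d' g
    using that by (simp add: H_def)
  \<comment> \<open>Naturality of \<open>e\<close>. It gives the counit at the end and also drives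
    the proof that \<open>G\<close> preserves composition.\<close>
  have eH: "Cmp D (omap F (c d)) (omap F (c d')) d' (e d') (H d d' g) = Cmp D (omap F (c d)) d d' g (e d)"
    if [simp]: "d \<in> Obj D" "d' \<in> Obj D" "g \<in> Hom D d d'" for d d' g
  proof -
    have "H d d' g = Cmp D (omap F (c d)) d' (omap F (c d')) (e' d') (Cmp D (omap F (c d)) d d' g (e d))"
      unfolding H_def by (subst D.Cmp_assoc) auto
    then show ?thesis by (simp add: D.cancel_left)
  qed
  have monic: "u = v" if "d \<in> Obj D" "w \<in> Obj D" "u \<in> Hom D w (omap F (c d))" "v \<in> Hom D w (omap F (c d))"
    "Cmp D w (omap F (c d)) d (e d) u = Cmp D w (omap F (c d)) d (e d) v" for d w u v
  proof -
    have c: "Cmp D w d (omap F (c d)) (e' d) (Cmp D w (omap F (c d)) d (e d) k) = k"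
      if "k \<in> Hom D w (omap F (c d))" for k
      using \<open>d \<in> Obj D\<close> \<open>w \<in> Obj D\<close> that by (intro D.cancel_left) auto
    show ?thesis using c[OF that(3)] c[OF that(4)] unfolding that(5) by simp
  qed
  have "is_functor D C G"
    unfolding is_functor_def
  proof (intro conjI ballI)
    fix d assume [simp]: "d \<in> Obj D"
    show "amap G d d (Ident D d) = Ident C (omap G d)"
      by (rule faithful[of "c d" "c d"]) (auto simp: G_def H_def)
  next
    fix x y z f g
    assume [simp]: "x \<in> Obj D" "y \<in> Obj D" "z \<in> Obj D" "f \<in> Hom D x y" "g \<in> Hom D y z"
    \<comment> \<open>The two candidates for the conjugate of a composite are compared after
      applying \<open>e z\<close>, which is split monic; there \<open>eH\<close> pushes the chosen
      isomorphisms past \<open>f\<close> and \<open>g\<close>.\<close>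
    have "Cmp D (omap F (c x)) (omap F (c z)) z (e z) (H x z (Cmp D x y z g f))
       = Cmp D (omap F (c x)) y z g (Cmp D (omap F (c x)) x y f (e x))"
      by (simp add: eH D.Cmp_assoc)
    also have "\<dots> = Cmp D (omap F (c x)) y z g (Cmp D (omap F (c x)) (omap F (c y)) y (e y) (H x y f))"
      by (simp add: eH)
    also have "\<dots> = Cmp D (omap F (c x)) (omap F (c y)) z (Cmp D (omap F (c y)) y z g (e y)) (H x y f)"
      by (simp add: D.Cmp_assoc)
    also have "\<dots> = Cmp D (omap F (c x)) (omap F (c y)) z (Cmp D (omap F (c y)) (omap F (c z)) z (e z) (H y z g)) (H x y f)"
      by (simp add: eH)
    also have "\<dots> = Cmp D (omap F (c x)) (omap F (c z)) z (e z)
       (Cmp D (omap F (c x)) (omap F (c y)) (omap F (c z)) (H y z g) (H x y f))"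
      by (simp add: D.Cmp_assoc)
    finally have "H x z (Cmp D x y z g f)
        = Cmp D (omap F (c x)) (omap F (c y)) (omap F (c z)) (H y z g) (H x y f)"
      by (rule monic[rotated -1]) auto
    then show "amap G x z (Cmp D x y z g f)
        = Cmp C (omap G x) (omap G y) (omap G z) (amap G y z g) (amap G x y f)"
      by (intro faithful[of "c x" "c z"]) (auto simp: G_def)
  qed (auto simp: G_def)
  \<comment> \<open>The unit at \<open>x\<close> is the lift of \<open>e'\<close> at the image of
    \<open>x\<close>, and the lift of \<open>e\<close> is its inverse. By faithfulness all
    identities may be checked after applying \<open>F\<close>.\<close>
  moreover have "natural_iso C C id_functor (comp_functor G F) (\<lambda>x. L x (c (omap F x)) (e' (omap F x)))"
    unfolding natural_iso_def
  proof (intro conjI ballI)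
    fix x assume [simp]: "x \<in> Obj C"
    let ?y = "c (omap F x)"
    have "Cmp C x ?y x (L ?y x (e (omap F x))) (L x ?y (e' (omap F x))) = Ident C x"
      by (rule faithful[of x x]) auto
    moreover have "Cmp C ?y x ?y (L x ?y (e' (omap F x))) (L ?y x (e (omap F x))) = Ident C ?y"
      by (rule faithful[of ?y ?y]) auto
    moreover have "L ?y x (e (omap F x)) \<in> Hom C ?y x" by simp
    ultimately show "is_iso C (omap id_functor x) (omap (comp_functor G F) x) (L x ?y (e' (omap F x)))"
      unfolding is_iso_def by (auto simp: id_functor_def comp_functor_def G_def)
  next
    fix x y f assume [simp]: "x \<in> Obj C" "y \<in> Obj C" "f \<in> Hom C x y"
    let ?x = "c (omap F x)" and ?y = "c (omap F y)"
    have "Cmp C x y ?y (L y ?y (e' (omap F y))) f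
        = Cmp C x ?x ?y (L ?x ?y (H (omap F x) (omap F y) (amap F x y f))) (L x ?x (e' (omap F x)))"
    proof (rule faithful[of x ?y])
      have "Cmp D (omap F x) (omap F ?x) (omap F ?y) (H (omap F x) (omap F y) (amap F x y f)) (e' (omap F x))
        = Cmp D (omap F x) (omap F y) (omap F ?y) (e' (omap F y)) (amap F x y f)"
        unfolding H_def by (simp add: D.cancel_right)
      then show "amap F x ?y (Cmp C x y ?y (L y ?y (e' (omap F y))) f)
        = amap F x ?y (Cmp C x ?x ?y (L ?x ?y (H (omap F x) (omap F y) (amap F x y f))) (L x ?x (e' (omap F x))))"
        by simp
    qed auto
    then show "Cmp C (omap id_functor x) (omap id_functor y) (omap (comp_functor G F) y)
        (L y ?y (e' (omap F y))) (amap id_functor x y f)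
      = Cmp C (omap id_functor x) (omap (comp_functor G F) x) (omap (comp_functor G F) y)
        (amap (comp_functor G F) x y f) (L x ?x (e' (omap F x)))"
      by (simp add: id_functor_def comp_functor_def G_def)
  qed
  moreover have "natural_iso D D (comp_functor F G) id_functor e"
    unfolding natural_iso_def
  proof (intro conjI ballI)
    fix d assume "d \<in> Obj D"
    then show "is_iso D (omap (comp_functor F G) d) (omap id_functor d) (e d)"
      unfolding is_iso_def by (auto simp: id_functor_def comp_functor_def G_def intro!: bexI[of _ "e' d"])
  qed (simp add: id_functor_def comp_functor_def G_def eH)
  ultimately show ?thesis using F unfolding is_equivalence_def by blast
qed

section \<open>A criterion for the coproduct functor to be an equivalence\<close>

definition cartesian_coprojections ::
  "('o, 'a) cat \<Rightarrow> 'i set \<Rightarrow> ('i \<Rightarrow> 'o) \<Rightarrow> ('i \<Rightarrow> 'o) \<Rightarrow> bool" where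
  "cartesian_coprojections C I A X \<longleftrightarrow> (\<forall>P \<iota> Q \<kappa> f u.
     is_coproduct C I A (P, \<iota>) \<longrightarrow> is_coproduct C I X (Q, \<kappa>) \<longrightarrow>
     (\<forall>i\<in>I. f i \<in> Hom C (A i) (X i)) \<longrightarrow> u \<in> Hom C P Q \<longrightarrow>
     (\<forall>i\<in>I. Cmp C (A i) P Q u (\<iota> i) = Cmp C (A i) (X i) Q (\<kappa> i) (f i)) \<longrightarrow>
     (\<forall>i\<in>I. \<forall>T\<in>Obj C. \<forall>a\<in>Hom C T P. \<forall>b\<in>Hom C T (X i).
        Cmp C T P Q u a = Cmp C T (X i) Q (\<kappa> i) b \<longrightarrow>
        (\<exists>!c. c \<in> Hom C T (A i) \<and> Cmp C T (A i) P (\<iota> i) c = a \<and> Cmp C T (A i) (X i) (f i) c = b)))"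

text \<open>An arrow over \<open>Q\<close> between two coproducts, restricted to the i-th summand,
  forms a cone over the i-th square of its target together with the structure map of that summand.
  The pullback property turns it into exactly one i-th component, which gives full faithfulness. By
  \<open>decomp\<close>, an object over \<open>Q\<close> is a coproduct of objects over the
  \<open>X i\<close>, hence isomorphic to the chosen coproduct of the same family.\<close>

theorem coproduct_functor_equivalence:
  assumes "category C" and S: "coproduct_choice C I S" and X: "X \<in> I \<rightarrow>\<^sub>E Obj C"
    and cart: "\<And>A. A \<in> I \<rightarrow>\<^sub>E Obj C \<Longrightarrow> cartesian_coprojections C I A X"
    and decomp: "\<And>Y h. Y \<in> Obj C \<Longrightarrow> h \<in> Hom C Y (fst (S X)) \<Longrightarrow>
      \<exists>A j f. A \<in> I \<rightarrow>\<^sub>E Obj C \<and> is_coproduct C I A (Y, j) \<and> (\<forall>i\<in>I. f i \<in> Hom C (A i) (X i) \<and>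
        Cmp C (A i) Y (fst (S X)) h (j i) = Cmp C (A i) (X i) (fst (S X)) (snd (S X) i) (f i))"
  shows "is_equivalence (product_category I (\<lambda>i. slice C (X i)))
    (slice C (fst (S X))) (coproduct_functor C I S X)"
proof -
  interpret category C by fact
  define Q where "Q = fst (S X)"
  define \<kappa> where "\<kappa> = snd (S X)"
  let ?K = "product_category I (\<lambda>i. slice C (X i))"
  let ?F = "coproduct_functor C I S X"
  \<comment> \<open>For an object \<open>p\<close> of the product of slices, \<open>dm p\<close> is
    the family of domains, \<open>cp p\<close> with \<open>inj p\<close> its chosen coproduct, and
    \<open>str p\<close> the induced map to \<open>Q\<close>. The restriction to \<open>I\<close>
    matches \<open>coproduct_functor\<close>, so that \<open>S\<close> receives literally the same
    argument.\<close>
  define dm where "dm p = (\<lambda>i\<in>I. fst (p i))" for p :: "'c \<Rightarrow> 'a \<times> 'b"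
  define cp where "cp p = fst (S (dm p))" for p
  define inj where "inj p = snd (S (dm p))" for p
  define str where "str p = snd (omap ?F p)" for p
  have SX: "S X = (Q, \<kappa>)" by (simp add: Q_def \<kappa>_def)
  have Sp: "S (dm p) = (cp p, inj p)" for p by (simp add: cp_def inj_def)
  have Q: "is_coproduct C I X (Q, \<kappa>)"
    using S X unfolding coproduct_choice_def SX[symmetric] by blast
  note QD = is_coproductD[OF Q]
  have XO: "\<And>i. i \<in> I \<Longrightarrow> X i \<in> Obj C" using X by auto
  have pO: "fst (p i) \<in> Obj C" "dm p i = fst (p i)" "snd (p i) \<in> Hom C (dm p i) (X i)"
    if "p \<in> Obj ?K" "i \<in> I" for p i
    using that by (auto simp: product_category_def slice_def dm_def PiE_iff case_prod_unfold)
  have dmE: "dm p \<in> I \<rightarrow>\<^sub>E Obj C" if "p \<in> Obj ?K" for p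
    using pO[OF that] unfolding dm_def by auto
  have dmO: "dm p i \<in> Obj C" if "p \<in> Obj ?K" "i \<in> I" for p i
    using pO[OF that] by simp
  have dmX: "dm p \<in> I \<rightarrow> Obj C" "X \<in> I \<rightarrow> Obj C" if "p \<in> Obj ?K" for p
    using dmO[OF that] XO by auto
  have cop: "is_coproduct C I (dm p) (cp p, inj p)" if "p \<in> Obj ?K" for p
    using S dmE[OF that] unfolding coproduct_choice_def Sp[symmetric] by blast
  note cpD = is_coproductD[OF cop]
  have kH: "k i \<in> Hom C (dm p i) (dm q i)" "Cmp C (dm p i) (dm q i) (X i) (snd (q i)) (k i) = snd (p i)"
    if "p \<in> Obj ?K" "q \<in> Obj ?K" "k \<in> Hom ?K p q" "i \<in> I" for p q k i
    using that by (auto simp: product_category_def slice_def dm_def PiE_iff case_prod_unfold)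
  have HK: "k \<in> Hom ?K p q" if "k \<in> extensional I"
    "\<And>i. i \<in> I \<Longrightarrow> k i \<in> Hom C (dm p i) (dm q i)"
    "\<And>i. i \<in> I \<Longrightarrow> Cmp C (dm p i) (dm q i) (X i) (snd (q i)) (k i) = snd (p i)" for p q k
    using that by (auto simp: product_category_def slice_def dm_def PiE_iff case_prod_unfold)
  have oF: "omap ?F p = (cp p, str p)" for p
    by (simp add: str_def coproduct_functor_def Let_def cp_def dm_def)
  have strE: "str p = coproduct_arrow C I (dm p) (cp p, inj p) X (Q, \<kappa>) (\<lambda>i. snd (p i))" for p
    unfolding str_def Sp[symmetric] SX[symmetric]
    by (simp add: coproduct_functor_def Let_def dm_def)
  have str: "str p \<in> Hom C (cp p) Q"
    "\<And>i. i \<in> I \<Longrightarrow> Cmp C (dm p i) (cp p) Q (str p) (inj p i) = Cmp C (dm p i) (X i) Q (\<kappa> i) (snd (p i))"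
    if "p \<in> Obj ?K" for p
    unfolding strE
    using coproduct_arrow[OF cop[OF that] Q dmX(1)[OF that] dmX(2)[OF that], of "\<lambda>i. snd (p i)"] pO(3)[OF that]
    by blast+
  have aE: "amap ?F p q k = coproduct_arrow C I (dm p) (cp p, inj p) (dm q) (cp q, inj q) k" for p q k
    unfolding Sp[symmetric] by (simp add: coproduct_functor_def Let_def dm_def)
  have a: "amap ?F p q k \<in> Hom C (cp p) (cp q)"
    "\<And>i. i \<in> I \<Longrightarrow> Cmp C (dm p i) (cp p) (cp q) (amap ?F p q k) (inj p i)
       = Cmp C (dm p i) (dm q i) (cp q) (inj q i) (k i)"
    if "p \<in> Obj ?K" "q \<in> Obj ?K" "k \<in> Hom ?K p q" for p q k
    unfolding aE
    using coproduct_arrow[OF cop[OF that(1)] cop[OF that(2)] dmX(1)[OF that(1)] dmX(1)[OF that(2)], of k]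
      kH(1)[OF that]
    by blast+
  have a_eqI: "amap ?F p q k = u" if "p \<in> Obj ?K" "q \<in> Obj ?K" "k \<in> Hom ?K p q" "u \<in> Hom C (cp p) (cp q)"
    "\<And>i. i \<in> I \<Longrightarrow> Cmp C (dm p i) (cp p) (cp q) u (inj p i)
       = Cmp C (dm p i) (dm q i) (cp q) (inj q i) (k i)" for p q k u
    unfolding aE
    by (rule coproduct_arrow_eqI[OF cop[OF that(1)] cop[OF that(2)] dmX(1)[OF that(1)] dmX(1)[OF that(2)]
        kH(1)[OF that(1-3)] that(4,5)])
  \<comment> \<open>The induced arrow is a morphism of the slice: on each coprojection both sides
    reduce to the i-th structure map of \<open>p\<close> followed by \<kappa> i.\<close>
  have over: "Cmp C (cp p) (cp q) Q (str q) (amap ?F p q k) = str p"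
    if p: "p \<in> Obj ?K" and q: "q \<in> Obj ?K" and k: "k \<in> Hom ?K p q" for p q k
  proof (rule coproduct_eqI[OF cop[OF p] QD(1) dmX(1)[OF p] _ str(1)[OF p]])
    show "Cmp C (cp p) (cp q) Q (str q) (amap ?F p q k) \<in> Hom C (cp p) Q"
      using a(1)[OF that] str(1)[OF q] cpD(1)[OF p] cpD(1)[OF q] QD(1) by (intro comp_in)
    fix i assume i: "i \<in> I"
    have "Cmp C (dm p i) (cp p) Q (Cmp C (cp p) (cp q) Q (str q) (amap ?F p q k)) (inj p i)
       = Cmp C (dm p i) (cp q) Q (str q) (Cmp C (dm p i) (dm q i) (cp q) (inj q i) (k i))"
      using a[OF that] i str(1)[OF q] cpD(1,2)[OF p] cpD(1)[OF q] QD(1) dmO[OF p i]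
      by (simp flip: Cmp_assoc)
    also have "\<dots> = Cmp C (dm p i) (dm q i) Q (Cmp C (dm q i) (X i) Q (\<kappa> i) (snd (q i))) (k i)"
      using kH(1)[OF that i] i str[OF q] cpD(1,2)[OF q] QD(1) dmO[OF p i] dmO[OF q i]
      by (simp add: Cmp_assoc)
    also have "\<dots> = Cmp C (dm p i) (X i) Q (\<kappa> i) (snd (p i))"
      using kH[OF that i] i QD(1,2) dmO[OF p i] dmO[OF q i] XO pO(3)[OF q i]
      by (simp flip: Cmp_assoc)
    finally show "Cmp C (dm p i) (cp p) Q (Cmp C (cp p) (cp q) Q (str q) (amap ?F p q k)) (inj p i)
       = Cmp C (dm p i) (cp p) Q (str p) (inj p i)"
      using str(2)[OF p i] by simp
  qed
  have catK: "category ?K"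
    using category_product[of I "\<lambda>i. slice C (X i)"] category_slice[OF \<open>category C\<close>] XO by blast
  have catD: "category (slice C Q)"
    by (rule category_slice[OF \<open>category C\<close> QD(1)])
  interpret K: category ?K by (rule catK)
  have "is_functor ?K (slice C Q) ?F"
    unfolding is_functor_def
  proof (intro conjI ballI)
    fix p assume p: "p \<in> Obj ?K"
    show "omap ?F p \<in> Obj (slice C Q)"
      using str(1)[OF p] cpD(1)[OF p] by (simp add: oF slice_def)
    have "amap ?F p p (Ident ?K p) = Ident C (cp p)"
    proof (rule a_eqI[OF p p K.Ident_in_Hom[OF p] Ident_in_Hom[OF cpD(1)[OF p]]])
      fix i assume i: "i \<in> I"
      have "Ident ?K p i = Ident C (dm p i)"
        using i by (simp add: product_category_def slice_def dm_def case_prod_unfold)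
      then show "Cmp C (dm p i) (cp p) (cp p) (Ident C (cp p)) (inj p i)
          = Cmp C (dm p i) (dm p i) (cp p) (inj p i) (Ident ?K p i)"
        using cpD(1,2)[OF p] i dmO[OF p i] by (simp add: Cmp_Ident_left Cmp_Ident_right)
    qed
    then show "amap ?F p p (Ident ?K p) = Ident (slice C Q) (omap ?F p)"
      by (simp add: oF slice_def)
  next
    fix p q k assume "p \<in> Obj ?K" "q \<in> Obj ?K" "k \<in> Hom ?K p q"
    then show "amap ?F p q k \<in> Hom (slice C Q) (omap ?F p) (omap ?F q)"
      using a(1) over by (simp add: oF slice_def)
  next
    fix p q r k l assume p: "p \<in> Obj ?K" and q: "q \<in> Obj ?K" and r: "r \<in> Obj ?K"
      and k: "k \<in> Hom ?K p q" and l: "l \<in> Hom ?K q r"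
    have "amap ?F p r (Cmp ?K p q r l k) = Cmp C (cp p) (cp q) (cp r) (amap ?F q r l) (amap ?F p q k)"
    proof (rule a_eqI[OF p r K.comp_in[OF k l p q r] comp_in[OF a(1)[OF p q k] a(1)[OF q r l] cpD(1)[OF p] cpD(1)[OF q] cpD(1)[OF r]]])
      fix i assume i: "i \<in> I"
      have "Cmp ?K p q r l k i = Cmp C (dm p i) (dm q i) (dm r i) (l i) (k i)"
        using i by (simp add: product_category_def slice_def dm_def case_prod_unfold)
      moreover have "Cmp C (dm p i) (cp p) (cp r) (Cmp C (cp p) (cp q) (cp r) (amap ?F q r l) (amap ?F p q k)) (inj p i)
          = Cmp C (dm p i) (cp q) (cp r) (amap ?F q r l) (Cmp C (dm p i) (dm q i) (cp q) (inj q i) (k i))"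
        using a[OF p q k] a(1)[OF q r l] i cpD(1,2)[OF p] cpD(1)[OF q] cpD(1)[OF r] dmO[OF p i]
        by (simp flip: Cmp_assoc)
      moreover have "\<dots> = Cmp C (dm p i) (dm q i) (cp r) (Cmp C (dm q i) (dm r i) (cp r) (inj r i) (l i)) (k i)"
        using a[OF q r l] kH(1)[OF p q k i] i cpD(1,2)[OF q] cpD(1)[OF r] dmO[OF p i] dmO[OF q i]
        by (simp add: Cmp_assoc)
      moreover have "\<dots> = Cmp C (dm p i) (dm r i) (cp r) (inj r i) (Cmp C (dm p i) (dm q i) (dm r i) (l i) (k i))"
        using kH(1)[OF p q k i] kH(1)[OF q r l i] i cpD(1,2)[OF r] dmO[OF p i] dmO[OF q i] dmO[OF r i]
        by (simp add: Cmp_assoc)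
      ultimately show "Cmp C (dm p i) (cp p) (cp r) (Cmp C (cp p) (cp q) (cp r) (amap ?F q r l) (amap ?F p q k)) (inj p i)
          = Cmp C (dm p i) (dm r i) (cp r) (inj r i) (Cmp ?K p q r l k i)"
        by simp
    qed
    then show "amap ?F p r (Cmp ?K p q r l k)
        = Cmp (slice C Q) (omap ?F p) (omap ?F q) (omap ?F r) (amap ?F q r l) (amap ?F p q k)"
      by (simp add: oF slice_def)
  qed
  moreover have "bij_betw (amap ?F p q) (Hom ?K p q) (Hom (slice C Q) (omap ?F p) (omap ?F q))"
    if p: "p \<in> Obj ?K" and q: "q \<in> Obj ?K" for p q
  proof -
    \<comment> \<open>The pullback square of \<open>q\<close> at \<open>i\<close>, tested on the
      domain \<open>dm p i\<close> with the restriction of \<open>h\<close> and the structure map of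
      \<open>p i\<close>. Its uniqueness part gives injectivity on arrows, its existence part
      surjectivity.\<close>
    have lift: "\<exists>!c. c \<in> Hom C (dm p i) (dm q i) \<and>
        Cmp C (dm p i) (dm q i) (cp q) (inj q i) c = Cmp C (dm p i) (cp p) (cp q) h (inj p i) \<and>
        Cmp C (dm p i) (dm q i) (X i) (snd (q i)) c = snd (p i)"
      if h: "h \<in> Hom C (cp p) (cp q)" "Cmp C (cp p) (cp q) Q (str q) h = str p" and i: "i \<in> I" for h i
    proof -
      have eq: "Cmp C (dm p i) (cp q) Q (str q) (Cmp C (dm p i) (cp p) (cp q) h (inj p i))
          = Cmp C (dm p i) (X i) Q (\<kappa> i) (snd (p i))"
        using h str[OF p] str(1)[OF q] i cpD(1,2)[OF p] cpD(1)[OF q] QD(1) dmO[OF p i]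
        by (simp add: Cmp_assoc)
      have "Cmp C (dm p i) (cp p) (cp q) h (inj p i) \<in> Hom C (dm p i) (cp q)"
        using h i cpD(1,2)[OF p] cpD(1)[OF q] dmO[OF p i] by (intro comp_in)
      then show ?thesis
        using cart[OF dmE[OF q], unfolded cartesian_coprojections_def, rule_format,
            OF cop[OF q] Q, of "\<lambda>i. snd (q i)" "str q" i "dm p i", OF _ str(1)[OF q] _ i dmO[OF p i] _ _ eq]
          pO(3)[OF q] pO(3)[OF p i] str(2)[OF q]
        by simp
    qed
    have "inj_on (amap ?F p q) (Hom ?K p q)"
    proof (rule inj_onI)
      fix k l assume k: "k \<in> Hom ?K p q" and l: "l \<in> Hom ?K p q" and eq: "amap ?F p q k = amap ?F p q l"
      show "k = l"
      proof (rule extensionalityI[of _ I])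
        fix i assume i: "i \<in> I"
        show "k i = l i"
          using lift[OF a(1)[OF p q k] over[OF p q k] i] kH[OF p q k i] kH[OF p q l i]
            a(2)[OF p q k i] a(2)[OF p q l i] unfolding eq by metis
      qed (use k l in \<open>auto simp: product_category_def PiE_iff\<close>)
    qed
    moreover have "amap ?F p q ` Hom ?K p q = Hom (slice C Q) (omap ?F p) (omap ?F q)"
    proof (intro equalityI subsetI)
      fix h assume "h \<in> amap ?F p q ` Hom ?K p q"
      then show "h \<in> Hom (slice C Q) (omap ?F p) (omap ?F q)"
        using a(1)[OF p q] over[OF p q] by (auto simp: oF slice_def)
    next
      fix h assume "h \<in> Hom (slice C Q) (omap ?F p) (omap ?F q)"
      then have h: "h \<in> Hom C (cp p) (cp q)" "Cmp C (cp p) (cp q) Q (str q) h = str p"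
        by (auto simp: oF slice_def)
      define k where "k = (\<lambda>i\<in>I. THE c. c \<in> Hom C (dm p i) (dm q i) \<and>
        Cmp C (dm p i) (dm q i) (cp q) (inj q i) c = Cmp C (dm p i) (cp p) (cp q) h (inj p i) \<and>
        Cmp C (dm p i) (dm q i) (X i) (snd (q i)) c = snd (p i))"
      have k: "k i \<in> Hom C (dm p i) (dm q i)"
        "Cmp C (dm p i) (dm q i) (cp q) (inj q i) (k i) = Cmp C (dm p i) (cp p) (cp q) h (inj p i)"
        "Cmp C (dm p i) (dm q i) (X i) (snd (q i)) (k i) = snd (p i)" if "i \<in> I" for i
        using theI'[OF lift[OF h that]] that by (auto simp: k_def)
      have kK: "k \<in> Hom ?K p q" using k(1,3) by (intro HK) (auto simp: k_def)
      have "amap ?F p q k = h"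
        using k(2) by (intro a_eqI[OF p q kK h(1)]) simp
      then show "h \<in> amap ?F p q ` Hom ?K p q" using kK by blast
    qed
    ultimately show ?thesis by (simp add: bij_betw_def)
  qed
  moreover have "\<exists>p\<in>Obj ?K. \<exists>e. is_iso (slice C Q) (omap ?F p) d e" if d: "d \<in> Obj (slice C Q)" for d
  proof -
    obtain Y h where Yh: "d = (Y, h)" "Y \<in> Obj C" "h \<in> Hom C Y Q"
      using d by (auto simp: slice_def)
    obtain A j f where A: "A \<in> I \<rightarrow>\<^sub>E Obj C" and Y: "is_coproduct C I A (Y, j)"
      and f: "\<And>i. i \<in> I \<Longrightarrow> f i \<in> Hom C (A i) (X i)"
      and hj: "\<And>i. i \<in> I \<Longrightarrow> Cmp C (A i) Y Q h (j i) = Cmp C (A i) (X i) Q (\<kappa> i) (f i)"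
      using decomp[OF Yh(2), folded Q_def, OF Yh(3), folded \<kappa>_def] by blast
    define p where "p = (\<lambda>i\<in>I. (A i, f i))"
    have p: "p \<in> Obj ?K"
      using A f by (auto simp: p_def product_category_def slice_def)
    have dm: "dm p = A"
      by (rule extensionalityI[of _ I]) (use A in \<open>auto simp: dm_def p_def PiE_iff\<close>)
    have A': "A \<in> I \<rightarrow> Obj C" using A by auto
    have cpA: "is_coproduct C I A (cp p, inj p)" using cop[OF p] dm by simp
    \<comment> \<open>The cocone \<open>j\<close> on \<open>Y\<close> and the chosen cocone have the
      same base family \<open>A\<close>, so they are compared by an isomorphism; that it lies over
      \<open>Q\<close> is checked on coprojections.\<close>
    obtain e where e: "is_iso C (cp p) Y e" "\<And>i. i \<in> I \<Longrightarrow> Cmp C (A i) (cp p) Y e (inj p i) = j i"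
      by (rule coproducts_iso[OF cpA Y A']) blast
    have eH: "e \<in> Hom C (cp p) Y" using e(1) by (rule is_isoE)
    have "Cmp C (cp p) Y Q h e = str p"
    proof (rule coproduct_eqI[OF cpA QD(1) A' _ str(1)[OF p]])
      show "Cmp C (cp p) Y Q h e \<in> Hom C (cp p) Q"
        using eH Yh cpD(1)[OF p] QD(1) by (intro comp_in)
      fix i assume i: "i \<in> I"
      then have sp: "snd (p i) = f i" by (simp add: p_def)
      have "A i \<in> Obj C" "inj p i \<in> Hom C (A i) (cp p)"
        using A' is_coproductD(2)[OF cpA] i by auto
      then have "Cmp C (A i) (cp p) Q (Cmp C (cp p) Y Q h e) (inj p i) = Cmp C (A i) Y Q h (j i)"
        using eH e(2)[OF i] Yh cpD(1)[OF p] QD(1) by (simp flip: Cmp_assoc)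
      then show "Cmp C (A i) (cp p) Q (Cmp C (cp p) Y Q h e) (inj p i)
          = Cmp C (A i) (cp p) Q (str p) (inj p i)"
        using hj[OF i] str(2)[OF p i] sp by (simp add: dm)
    qed
    then have "is_iso (slice C Q) (omap ?F p) d e"
      unfolding oF Yh(1) using e(1) Yh cpD(1)[OF p] QD(1) by (intro is_iso_slice[OF \<open>category C\<close>])
    then show ?thesis using p by blast
  qed
  ultimately show ?thesis
    unfolding Q_def[symmetric] by (intro fully_faithful_surjective_imp_equivalence[OF catK catD])
qed

section \<open>Graphs over a category with a strict initial object\<close>

abbreviation vset :: "('v::set_domain, 'o) vgraph \<Rightarrow> 'v set" where
  "vset G \<equiv> elts (verts G)"

lemma Obj_GphD:
  assumes "G \<in> Obj (Gph U V)"
  shows "verts G \<in> elts U" "x \<in> vset G \<Longrightarrow> y \<in> vset G \<Longrightarrow> edge G x y \<in> Obj V"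
  using assms by (auto simp: Gph_def small_vgraphs_def)

lemma Hom_GphD:
  assumes "m \<in> Hom (Gph U V) G H" "x \<in> vset G"
  shows "fst m x \<in> vset H"
    "y \<in> vset G \<Longrightarrow> snd m x y \<in> Hom V (edge G x y) (edge H (fst m x) (fst m y))"
  using assms by (auto simp: Gph_def vgraph_hom_def PiE_iff)

lemma Hom_GphI:
  assumes "\<And>x. x \<in> vset G \<Longrightarrow> f x \<in> vset H"
    and "\<And>x y. x \<in> vset G \<Longrightarrow> y \<in> vset G \<Longrightarrow> \<phi> x y \<in> Hom V (edge G x y) (edge H (f x) (f y))"
  shows "(\<lambda>x\<in>vset G. f x, \<lambda>x\<in>vset G. \<lambda>y\<in>vset G. \<phi> x y) \<in> Hom (Gph U V) G H"
  using assms by (auto simp: Gph_def vgraph_hom_def)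

text \<open>Both components of an arrow are extensional functions, fixed off the vertex set, so
  agreement on vertices and on pairs of vertices is enough.\<close>

lemma Hom_Gph_eqI:
  assumes m: "m \<in> Hom (Gph U V) G H" and n: "n \<in> Hom (Gph U V) G H"
    and f: "\<And>x. x \<in> vset G \<Longrightarrow> fst m x = fst n x"
    and e: "\<And>x y. x \<in> vset G \<Longrightarrow> y \<in> vset G \<Longrightarrow> snd m x y = snd n x y"
  shows "m = n"
proof (rule prod_eqI)
  show "fst m = fst n"
    by (rule extensionalityI[of _ "vset G"])
      (use m n f in \<open>auto simp: Gph_def vgraph_hom_def PiE_iff\<close>)
  show "snd m = snd n"
  proof (rule extensionalityI[of _ "vset G"])
    fix x assume x: "x \<in> vset G"
    show "snd m x = snd n x"
      by (rule extensionalityI[of _ "vset G"])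
        (use m n e x in \<open>auto simp: Gph_def vgraph_hom_def PiE_iff\<close>)
  qed (use m n in \<open>auto simp: Gph_def vgraph_hom_def PiE_iff\<close>)
qed

text \<open>Composition is defined by matching on pairs; with projections, equations between arrows
  can be evaluated without splitting them.\<close>

lemma Cmp_Gph:
  assumes "x \<in> vset G"
  shows "fst (Cmp (Gph U V) G H K n m) x = fst n (fst m x)"
    "y \<in> vset G \<Longrightarrow> snd (Cmp (Gph U V) G H K n m) x y
      = Cmp V (edge G x y) (edge H (fst m x) (fst m y)) (edge K (fst n (fst m x)) (fst n (fst m y)))
          (snd n (fst m x) (fst m y)) (snd m x y)"
  using assms by (auto simp: Gph_def case_prod_unfold)

lemma Ident_Gph:
  assumes "x \<in> vset G"
  shows "fst (Ident (Gph U V) G) x = x"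
    "y \<in> vset G \<Longrightarrow> snd (Ident (Gph U V) G) x y = Ident V (edge G x y)"
  using assms by (auto simp: Gph_def)

lemma category_Gph:
  assumes "category V"
  shows "category (Gph U V)"
proof -
  interpret category V by fact
  have cmp: "Cmp (Gph U V) G H K n m \<in> Hom (Gph U V) G K"
    if O: "G \<in> Obj (Gph U V)" "H \<in> Obj (Gph U V)" "K \<in> Obj (Gph U V)"
      and m: "m \<in> Hom (Gph U V) G H" and n: "n \<in> Hom (Gph U V) H K" for G H K m n
  proof -
    have "Cmp (Gph U V) G H K n m = (\<lambda>x\<in>vset G. fst n (fst m x), \<lambda>x\<in>vset G. \<lambda>y\<in>vset G.
      Cmp V (edge G x y) (edge H (fst m x) (fst m y)) (edge K (fst n (fst m x)) (fst n (fst m y)))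
          (snd n (fst m x) (fst m y)) (snd m x y))"
      by (simp add: Gph_def case_prod_unfold)
    also have "\<dots> \<in> Hom (Gph U V) G K"
      by (rule Hom_GphI) (auto intro!: comp_in Hom_GphD[OF m] Hom_GphD[OF n] Obj_GphD[OF O(1)]
          Obj_GphD[OF O(2)] Obj_GphD[OF O(3)])
    finally show ?thesis .
  qed
  have idt: "Ident (Gph U V) G \<in> Hom (Gph U V) G G" if "G \<in> Obj (Gph U V)" for G
  proof -
    have "Ident (Gph U V) G = (\<lambda>x\<in>vset G. x, \<lambda>x\<in>vset G. \<lambda>y\<in>vset G. Ident V (edge G x y))"
      by (simp add: Gph_def)
    also have "\<dots> \<in> Hom (Gph U V) G G"
      by (rule Hom_GphI) (auto intro!: Ident_in_Hom Obj_GphD[OF that])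
    finally show ?thesis .
  qed
  show ?thesis
  proof
    fix G H m assume O: "G \<in> Obj (Gph U V)" "H \<in> Obj (Gph U V)" and m: "m \<in> Hom (Gph U V) G H"
    show "Cmp (Gph U V) G G H m (Ident (Gph U V) G) = m"
      by (rule Hom_Gph_eqI[OF cmp[OF O(1,1,2) idt[OF O(1)] m] m])
        (simp_all add: Cmp_Gph Ident_Gph Cmp_Ident_right Obj_GphD[OF O(1)] Obj_GphD[OF O(2)] Hom_GphD[OF m])
    show "Cmp (Gph U V) G H H (Ident (Gph U V) H) m = m"
      by (rule Hom_Gph_eqI[OF cmp[OF O(1,2,2) m idt[OF O(2)]] m])
        (simp_all add: Cmp_Gph Ident_Gph Cmp_Ident_left Obj_GphD[OF O(1)] Obj_GphD[OF O(2)] Hom_GphD[OF m])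
  next
    fix F G H K l m n
    assume O: "F \<in> Obj (Gph U V)" "G \<in> Obj (Gph U V)" "H \<in> Obj (Gph U V)" "K \<in> Obj (Gph U V)"
      and h: "l \<in> Hom (Gph U V) F G" "m \<in> Hom (Gph U V) G H" "n \<in> Hom (Gph U V) H K"
    show "Cmp (Gph U V) F H K n (Cmp (Gph U V) F G H m l) = Cmp (Gph U V) F G K (Cmp (Gph U V) G H K n m) l"
      by (rule Hom_Gph_eqI[OF cmp[OF O(1,3,4) cmp[OF O(1,2,3) h(1,2)] h(3)]
            cmp[OF O(1,2,4) h(1) cmp[OF O(2,3,4) h(2,3)]]])
        (simp_all add: Cmp_Gph Hom_GphD[OF h(1)] Hom_GphD[OF h(2)] Hom_GphD[OF h(3)]
          Obj_GphD[OF O(1)] Obj_GphD[OF O(2)] Obj_GphD[OF O(3)] Obj_GphD[OF O(4)] Cmp_assoc)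
  qed (use cmp idt in auto)
qed

section \<open>Strictness and full embeddings\<close>

locale vgraphs = category V for V :: "('o, 'a) cat" +
  fixes U :: "'v::set_domain" and z :: 'o
  assumes U: "universe U" and z: "strict_initial_object V z"
begin

sublocale Gph: category "Gph U V"
  by (rule category_Gph) unfold_locales

lemma z_initial: "initial_object V z" and z_Obj: "z \<in> Obj V"
  using z by (simp_all add: strict_initial_object_def initial_object_def)

text \<open>Strictness is given at \<open>z\<close>, whereas edge objects between components need
  not be \<open>z\<close> itself. Following \<open>f\<close> by a map from \<open>w\<close> to
  \<open>z\<close> gives an arrow into \<open>z\<close>, hence an isomorphism, along which
  \<open>x\<close> inherits initiality.\<close>

lemma initial_object_strict:
  assumes w: "initial_object V w" and f: "f \<in> Hom V x w" and x: "x \<in> Obj V"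
  shows "initial_object V x"
proof -
  obtain g where g: "g \<in> Hom V w z" and wO: "w \<in> Obj V"
    using w z_Obj unfolding initial_object_def by blast
  have "Cmp V x w z g f \<in> Hom V x z" using f g x wO z_Obj by (rule comp_in)
  then have "is_iso V x z (Cmp V x w z g f)"
    using z x unfolding strict_initial_object_def by blast
  then show ?thesis using initial_object_iso[OF z_initial _ x] by blast
qed

text \<open>Inclusions of full subgraphs up to isomorphism. Edge components are required to be
  invertible, not identities, so that the notion is stable under composition with isomorphisms of
  graphs.\<close>

definition full_embedding ::
  "('v, 'o) vgraph \<Rightarrow> ('v, 'o) vgraph \<Rightarrow> ('v \<Rightarrow> 'v) \<times> ('v \<Rightarrow> 'v \<Rightarrow> 'a) \<Rightarrow> bool" where
  "full_embedding G H m \<longleftrightarrow> m \<in> Hom (Gph U V) G H \<and> inj_on (fst m) (vset G) \<and>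
     (\<forall>x\<in>vset G. \<forall>y\<in>vset G. is_iso V (edge G x y) (edge H (fst m x) (fst m y)) (snd m x y))"

text \<open>The hypothesis speaks about vertices alone: the edges of the factorization are those of
  \<open>a\<close> followed by the inverses of the edge components of \<open>m\<close>.\<close>

lemma full_embedding_factor:
  assumes m: "full_embedding G H m"
    and T: "T \<in> Obj (Gph U V)" and G: "G \<in> Obj (Gph U V)" and H: "H \<in> Obj (Gph U V)"
    and a: "a \<in> Hom (Gph U V) T H" and im: "fst a ` vset T \<subseteq> fst m ` vset G"
  obtains c where "c \<in> Hom (Gph U V) T G" "Cmp (Gph U V) T G H m c = a"
proof -
  have mH: "m \<in> Hom (Gph U V) G H" and inj: "inj_on (fst m) (vset G)"
    and iso: "\<And>x y. x \<in> vset G \<Longrightarrow> y \<in> vset G \<Longrightarrow>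
      is_iso V (edge G x y) (edge H (fst m x) (fst m y)) (snd m x y)"
    using m unfolding full_embedding_def by blast+
  have "\<forall>t\<in>vset T. \<exists>x. x \<in> vset G \<and> fst m x = fst a t" using im by fastforce
  then obtain f where f: "\<And>t. t \<in> vset T \<Longrightarrow> f t \<in> vset G"
    and mf: "\<And>t. t \<in> vset T \<Longrightarrow> fst m (f t) = fst a t" by metis
  have "\<exists>\<phi>. \<phi> \<in> Hom V (edge T s t) (edge G (f s) (f t)) \<and>
      Cmp V (edge T s t) (edge G (f s) (f t)) (edge H (fst a s) (fst a t)) (snd m (f s) (f t)) \<phi> = snd a s t"
    if st: "s \<in> vset T" "t \<in> vset T" for s t
  proof -
    obtain g where g: "snd m (f s) (f t) \<in> Hom V (edge G (f s) (f t)) (edge H (fst a s) (fst a t))"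
      "g \<in> Hom V (edge H (fst a s) (fst a t)) (edge G (f s) (f t))"
      "Cmp V (edge H (fst a s) (fst a t)) (edge G (f s) (f t)) (edge H (fst a s) (fst a t)) (snd m (f s) (f t)) g
        = Ident V (edge H (fst a s) (fst a t))"
      using iso[OF f[OF st(1)] f[OF st(2)]] unfolding mf[OF st(1)] mf[OF st(2)] by (rule is_isoE)
    have O: "edge T s t \<in> Obj V" "edge H (fst a s) (fst a t) \<in> Obj V" "edge G (f s) (f t) \<in> Obj V"
      using st Obj_GphD(2)[OF T] Obj_GphD(2)[OF G] Obj_GphD(2)[OF H] Hom_GphD(1)[OF a] f by auto
    show ?thesis
      using cancel_left[OF g(3,2,1) Hom_GphD(2)[OF a st] O] comp_in[OF Hom_GphD(2)[OF a st] g(2) O] by blast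
  qed
  then obtain \<phi> where \<phi>: "\<And>s t. s \<in> vset T \<Longrightarrow> t \<in> vset T \<Longrightarrow> \<phi> s t \<in> Hom V (edge T s t) (edge G (f s) (f t))"
    and m\<phi>: "\<And>s t. s \<in> vset T \<Longrightarrow> t \<in> vset T \<Longrightarrow>
      Cmp V (edge T s t) (edge G (f s) (f t)) (edge H (fst a s) (fst a t)) (snd m (f s) (f t)) (\<phi> s t) = snd a s t"
    by metis
  let ?c = "(\<lambda>x\<in>vset T. f x, \<lambda>x\<in>vset T. \<lambda>y\<in>vset T. \<phi> x y)"
  have c: "?c \<in> Hom (Gph U V) T G" using f \<phi> by (rule Hom_GphI)
  have "Cmp (Gph U V) T G H m ?c = a"
    by (rule Hom_Gph_eqI[OF Gph.comp_in[OF c mH T G H] a]) (simp_all add: Cmp_Gph mf m\<phi>)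
  then show ?thesis using c that by blast
qed

text \<open>Injectivity settles the vertices first; only then do the edge components of
  \<open>c\<close> and \<open>d\<close> have a common codomain, and the isomorphism can be
  cancelled.\<close>

lemma full_embedding_monic:
  assumes m: "full_embedding G H m"
    and T: "T \<in> Obj (Gph U V)" and G: "G \<in> Obj (Gph U V)" and H: "H \<in> Obj (Gph U V)"
    and c: "c \<in> Hom (Gph U V) T G" and d: "d \<in> Hom (Gph U V) T G"
    and eq: "Cmp (Gph U V) T G H m c = Cmp (Gph U V) T G H m d"
  shows "c = d"
proof -
  have inj: "inj_on (fst m) (vset G)"
    and iso: "\<And>x y. x \<in> vset G \<Longrightarrow> y \<in> vset G \<Longrightarrow>
      is_iso V (edge G x y) (edge H (fst m x) (fst m y)) (snd m x y)"
    using m unfolding full_embedding_def by blast+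
  have v: "fst c t = fst d t" if t: "t \<in> vset T" for t
  proof (rule inj_onD[OF inj])
    show "fst m (fst c t) = fst m (fst d t)"
      using eq Cmp_Gph(1)[OF t] by metis
  qed (use t Hom_GphD(1)[OF c] Hom_GphD(1)[OF d] in auto)
  show ?thesis
  proof (rule Hom_Gph_eqI[OF c d v])
    fix s t assume st: "s \<in> vset T" "t \<in> vset T"
    have cO: "fst c s \<in> vset G" "fst c t \<in> vset G" using Hom_GphD(1)[OF c] st by auto
    note I = iso[OF cO]
    show "snd c s t = snd d s t"
    proof (rule iso_cancel_left[OF I])
      show "snd c s t \<in> Hom V (edge T s t) (edge G (fst c s) (fst c t))"
        using Hom_GphD(2)[OF c] st by blast
      show "snd d s t \<in> Hom V (edge T s t) (edge G (fst c s) (fst c t))"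
        using Hom_GphD(2)[OF d] st v by simp
      have mH: "m \<in> Hom (Gph U V) G H" using m unfolding full_embedding_def by blast
      show "edge H (fst m (fst c s)) (fst m (fst c t)) \<in> Obj V"
        using Obj_GphD(2)[OF H] Hom_GphD(1)[OF mH] cO by blast
      show "Cmp V (edge T s t) (edge G (fst c s) (fst c t)) (edge H (fst m (fst c s)) (fst m (fst c t)))
          (snd m (fst c s) (fst c t)) (snd c s t)
        = Cmp V (edge T s t) (edge G (fst c s) (fst c t)) (edge H (fst m (fst c s)) (fst m (fst c t)))
          (snd m (fst c s) (fst c t)) (snd d s t)"
        using arg_cong[OF eq, of "\<lambda>k. snd k s t"] st v by (simp add: Cmp_Gph)
    qed (use st cO Obj_GphD(2)[OF T] Obj_GphD(2)[OF G] in auto)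
  qed
qed

lemma full_embedding_comp:
  assumes m: "full_embedding G H m" and n: "full_embedding H K n"
    and G: "G \<in> Obj (Gph U V)" and H: "H \<in> Obj (Gph U V)" and K: "K \<in> Obj (Gph U V)"
  shows "full_embedding G K (Cmp (Gph U V) G H K n m)"
proof -
  have mH: "m \<in> Hom (Gph U V) G H" "inj_on (fst m) (vset G)"
    and misom: "\<And>x y. x \<in> vset G \<Longrightarrow> y \<in> vset G \<Longrightarrow>
      is_iso V (edge G x y) (edge H (fst m x) (fst m y)) (snd m x y)"
    using m unfolding full_embedding_def by blast+
  have nH: "n \<in> Hom (Gph U V) H K" "inj_on (fst n) (vset H)"
    and niso: "\<And>x y. x \<in> vset H \<Longrightarrow> y \<in> vset H \<Longrightarrow>
      is_iso V (edge H x y) (edge K (fst n x) (fst n y)) (snd n x y)"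
    using n unfolding full_embedding_def by blast+
  note v = Hom_GphD(1)[OF mH(1)] Hom_GphD(1)[OF nH(1)]
  have "inj_on (fst (Cmp (Gph U V) G H K n m)) (vset G)"
    using mH(2) nH(2) v by (auto simp: inj_on_def Cmp_Gph)
  moreover have "is_iso V (edge G x y) (edge K (fst n (fst m x)) (fst n (fst m y)))
      (snd (Cmp (Gph U V) G H K n m) x y)" if "x \<in> vset G" "y \<in> vset G" for x y
    unfolding Cmp_Gph(2)[OF that]
    using that by (intro iso_comp misom niso Obj_GphD[OF G] Obj_GphD[OF H] Obj_GphD[OF K] v)
  ultimately show ?thesis
    unfolding full_embedding_def using Gph.comp_in[OF mH(1) nH(1) G H K] by (simp add: Cmp_Gph)
qed

text \<open>The edges of the inverse \<open>d\<close>, taken at the images of the vertices, invert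
  the edges of \<open>e\<close>. This carries the disjoint form of a cocone along a comparison
  isomorphism.\<close>

lemma iso_full_embedding:
  assumes e: "is_iso (Gph U V) G H e" and G: "G \<in> Obj (Gph U V)" and H: "H \<in> Obj (Gph U V)"
  shows "full_embedding G H e" "fst e ` vset G = vset H"
proof -
  obtain d where d: "e \<in> Hom (Gph U V) G H" "d \<in> Hom (Gph U V) H G"
    "Cmp (Gph U V) G H G d e = Ident (Gph U V) G" "Cmp (Gph U V) H G H e d = Ident (Gph U V) H"
    using e by (rule Gph.is_isoE)
  have de: "fst d (fst e x) = x" if "x \<in> vset G" for x
    using arg_cong[OF d(3), of "\<lambda>k. fst k x"] that by (simp add: Cmp_Gph Ident_Gph)
  have ed: "fst e (fst d x) = x" if "x \<in> vset H" for x
    using arg_cong[OF d(4), of "\<lambda>k. fst k x"] that by (simp add: Cmp_Gph Ident_Gph)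
  show im: "fst e ` vset G = vset H"
    using Hom_GphD(1)[OF d(1)] Hom_GphD(1)[OF d(2)] ed by force
  have "inj_on (fst e) (vset G)" using de by (rule inj_on_inverseI)
  moreover have "is_iso V (edge G x y) (edge H (fst e x) (fst e y)) (snd e x y)"
    if xy: "x \<in> vset G" "y \<in> vset G" for x y
  proof -
    have exy: "fst e x \<in> vset H" "fst e y \<in> vset H" using Hom_GphD(1)[OF d(1)] xy by auto
    have "snd d (fst e x) (fst e y) \<in> Hom V (edge H (fst e x) (fst e y)) (edge G x y)"
      using Hom_GphD(2)[OF d(2) exy] de xy by simp
    moreover have "Cmp V (edge G x y) (edge H (fst e x) (fst e y)) (edge G x y)
        (snd d (fst e x) (fst e y)) (snd e x y) = Ident V (edge G x y)"
      using arg_cong[OF d(3), of "\<lambda>k. snd k x y"] xy de by (simp add: Cmp_Gph Ident_Gph)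
    moreover have "Cmp V (edge H (fst e x) (fst e y)) (edge G x y) (edge H (fst e x) (fst e y))
        (snd e x y) (snd d (fst e x) (fst e y)) = Ident V (edge H (fst e x) (fst e y))"
      using arg_cong[OF d(4), of "\<lambda>k. snd k (fst e x) (fst e y)"] xy exy de by (simp add: Cmp_Gph Ident_Gph)
    ultimately show ?thesis
      unfolding is_iso_def using Hom_GphD(2)[OF d(1) xy] by blast
  qed
  ultimately show "full_embedding G H e" unfolding full_embedding_def using d(1) by blast
qed

section \<open>Disjoint unions are exactly the coproducts\<close>

text \<open>An internal description of coproduct cocones, free of universal quantification over
  target graphs. For empty \<open>I\<close> the covering clause forces \<open>P\<close> to have no
  vertices.\<close>

definition disjoint_cocone ::
  "'i set \<Rightarrow> ('i \<Rightarrow> ('v, 'o) vgraph) \<Rightarrow> ('v, 'o) vgraph \<Rightarrow> ('i \<Rightarrow> ('v \<Rightarrow> 'v) \<times> ('v \<Rightarrow> 'v \<Rightarrow> 'a)) \<Rightarrow> bool" where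
  "disjoint_cocone I A P \<iota> \<longleftrightarrow> P \<in> Obj (Gph U V) \<and> (\<forall>i\<in>I. full_embedding (A i) P (\<iota> i)) \<and>
     (\<forall>p\<in>vset P. \<exists>i\<in>I. p \<in> fst (\<iota> i) ` vset (A i)) \<and>
     (\<forall>i\<in>I. \<forall>j\<in>I. \<forall>x\<in>vset (A i). \<forall>y\<in>vset (A j). i \<noteq> j \<longrightarrow>
        fst (\<iota> i) x \<noteq> fst (\<iota> j) y \<and> initial_object V (edge P (fst (\<iota> i) x) (fst (\<iota> j) y)))"

lemma disjoint_coconeD:
  assumes "disjoint_cocone I A P \<iota>"
  shows "P \<in> Obj (Gph U V)" "\<And>i. i \<in> I \<Longrightarrow> full_embedding (A i) P (\<iota> i)"
    "\<And>i. i \<in> I \<Longrightarrow> \<iota> i \<in> Hom (Gph U V) (A i) P"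
    "\<And>p. p \<in> vset P \<Longrightarrow> \<exists>i\<in>I. \<exists>x\<in>vset (A i). fst (\<iota> i) x = p"
    "\<And>i j x y. \<lbrakk>i \<in> I; j \<in> I; x \<in> vset (A i); y \<in> vset (A j); fst (\<iota> i) x = fst (\<iota> j) y\<rbrakk> \<Longrightarrow> i = j"
    "\<And>i j x y. \<lbrakk>i \<in> I; j \<in> I; x \<in> vset (A i); y \<in> vset (A j); i \<noteq> j\<rbrakk>
      \<Longrightarrow> initial_object V (edge P (fst (\<iota> i) x) (fst (\<iota> j) y))"
  using assms unfolding disjoint_cocone_def full_embedding_def by (blast | metis imageE)+

text \<open>A vertex of \<open>P\<close> has a unique origin, which dictates the vertex map. Inside
  a component the edge map is forced by inverting the edge of \<iota> i; between components the edge
  object is initial and has just one map to any object.\<close>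

lemma disjoint_cocone_is_coproduct:
  assumes dc: "disjoint_cocone I A P \<iota>" and A: "A \<in> I \<rightarrow> Obj (Gph U V)"
  shows "is_coproduct (Gph U V) I A (P, \<iota>)"
proof -
  note D = disjoint_coconeD[OF dc]
  have emb: "inj_on (fst (\<iota> i)) (vset (A i))" "\<And>x y. x \<in> vset (A i) \<Longrightarrow> y \<in> vset (A i) \<Longrightarrow>
      is_iso V (edge (A i) x y) (edge P (fst (\<iota> i) x) (fst (\<iota> i) y)) (snd (\<iota> i) x y)" if "i \<in> I" for i
    using D(2)[OF that] unfolding full_embedding_def by blast+
  have \<iota>v: "fst (\<iota> i) x \<in> vset P" if "i \<in> I" "x \<in> vset (A i)" for i x
    using Hom_GphD(1)[OF D(3)] that by blast
  have AO: "edge (A i) x y \<in> Obj V" if "i \<in> I" "x \<in> vset (A i)" "y \<in> vset (A i)" for i x y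
    using A that by (intro Obj_GphD(2)) auto
  \<comment> \<open>The component of a vertex of \<open>P\<close> and its preimage there;
    \<open>idx\<close> and \<open>pt\<close> below show them to be uniquely determined.\<close>
  obtain idx pt where ip: "\<And>p. p \<in> vset P \<Longrightarrow> idx p \<in> I" "\<And>p. p \<in> vset P \<Longrightarrow> pt p \<in> vset (A (idx p))"
    "\<And>p. p \<in> vset P \<Longrightarrow> fst (\<iota> (idx p)) (pt p) = p"
    using D(4) by metis
  have idx: "idx (fst (\<iota> i) x) = i" if "i \<in> I" "x \<in> vset (A i)" for i x
    using ip[OF \<iota>v[OF that]] D(5) that by blast
  have pt: "pt (fst (\<iota> i) x) = x" if "i \<in> I" "x \<in> vset (A i)" for i x
    using ip[OF \<iota>v[OF that]] idx[OF that] inj_onD[OF emb(1)] that by metis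
  have "\<exists>!u. u \<in> Hom (Gph U V) P Z \<and> (\<forall>i\<in>I. Cmp (Gph U V) (A i) P Z u (\<iota> i) = g i)"
    if Z: "Z \<in> Obj (Gph U V)" and g: "g \<in> (\<Pi> i\<in>I. Hom (Gph U V) (A i) Z)" for Z g
  proof -
    have gH: "g i \<in> Hom (Gph U V) (A i) Z" if "i \<in> I" for i using g that by blast
    have PO: "edge P p q \<in> Obj V" if "p \<in> vset P" "q \<in> vset P" for p q
      using Obj_GphD(2)[OF D(1)] that by blast
    have ZO: "edge Z p q \<in> Obj V" if "p \<in> vset Z" "q \<in> vset Z" for p q
      using Obj_GphD(2)[OF Z] that by blast
    define f where "f p = fst (g (idx p)) (pt p)" for p
    have f: "f p \<in> vset Z" if "p \<in> vset P" for p
      unfolding f_def using Hom_GphD(1)[OF gH] ip that by blast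
    have f\<iota>: "f (fst (\<iota> i) x) = fst (g i) x" if "i \<in> I" "x \<in> vset (A i)" for i x
      unfolding f_def using idx[OF that] pt[OF that] by simp
    \<comment> \<open>Compatibility with \<open>g\<close> constrains only edges inside one
      component, hence the guard \<open>idx p = idx q\<close>.\<close>
    have "\<exists>\<phi>. \<phi> \<in> Hom V (edge P p q) (edge Z (f p) (f q)) \<and> (idx p = idx q \<longrightarrow>
       Cmp V (edge (A (idx p)) (pt p) (pt q)) (edge P p q) (edge Z (f p) (f q)) \<phi> (snd (\<iota> (idx p)) (pt p) (pt q))
       = snd (g (idx p)) (pt p) (pt q))" if pq: "p \<in> vset P" "q \<in> vset P" for p q
    proof (cases "idx p = idx q")
      case True
      note i = ip(1)[OF pq(1)]
      have v: "pt p \<in> vset (A (idx p))" "pt q \<in> vset (A (idx p))"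
            using ip(2)[OF pq(1)] ip(2)[OF pq(2)] True by simp_all
      have eq: "fst (\<iota> (idx p)) (pt p) = p" "fst (\<iota> (idx p)) (pt q) = q"
            using ip(3)[OF pq(1)] ip(3)[OF pq(2)] True by simp_all
      obtain h where h: "snd (\<iota> (idx p)) (pt p) (pt q) \<in> Hom V (edge (A (idx p)) (pt p) (pt q)) (edge P p q)"
        "h \<in> Hom V (edge P p q) (edge (A (idx p)) (pt p) (pt q))"
        "Cmp V (edge (A (idx p)) (pt p) (pt q)) (edge P p q) (edge (A (idx p)) (pt p) (pt q))
          h (snd (\<iota> (idx p)) (pt p) (pt q)) = Ident V (edge (A (idx p)) (pt p) (pt q))"
        using emb(2)[OF i v] unfolding eq by (rule is_isoE)
      have k: "snd (g (idx p)) (pt p) (pt q) \<in> Hom V (edge (A (idx p)) (pt p) (pt q)) (edge Z (f p) (f q))"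
        using Hom_GphD(2)[OF gH[OF i] v] True by (simp add: f_def)
      note O = AO[OF i v] PO[OF pq] ZO[OF f[OF pq(1)] f[OF pq(2)]]
      show ?thesis
        using comp_in[OF h(2) k O(2,1,3)] cancel_right[OF h(3,1,2) k O(3,1,2)] by blast
    next
      case False
      have "initial_object V (edge P p q)"
        using D(6)[OF ip(1)[OF pq(1)] ip(1)[OF pq(2)] ip(2)[OF pq(1)] ip(2)[OF pq(2)] False] ip(3) pq by simp
      then have "\<exists>\<phi>. \<phi> \<in> Hom V (edge P p q) (edge Z (f p) (f q))"
        using ZO[OF f[OF pq(1)] f[OF pq(2)]] unfolding initial_object_def by blast
      then show ?thesis using False by blast
    qed
    then obtain \<phi> where \<phi>: "\<And>p q. p \<in> vset P \<Longrightarrow> q \<in> vset P \<Longrightarrow> \<phi> p q \<in> Hom V (edge P p q) (edge Z (f p) (f q))"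
      and \<phi>\<iota>: "\<And>p q. p \<in> vset P \<Longrightarrow> q \<in> vset P \<Longrightarrow> idx p = idx q \<Longrightarrow>
       Cmp V (edge (A (idx p)) (pt p) (pt q)) (edge P p q) (edge Z (f p) (f q)) (\<phi> p q) (snd (\<iota> (idx p)) (pt p) (pt q))
       = snd (g (idx p)) (pt p) (pt q)"
      by metis
    let ?u = "(\<lambda>x\<in>vset P. f x, \<lambda>x\<in>vset P. \<lambda>y\<in>vset P. \<phi> x y)"
    have u: "?u \<in> Hom (Gph U V) P Z" using f \<phi> by (rule Hom_GphI)
    show ?thesis
    proof (rule ex1I[of _ ?u], intro conjI ballI u)
      fix i assume i: "i \<in> I"
      have Ai: "A i \<in> Obj (Gph U V)" using A i by blast
      show "Cmp (Gph U V) (A i) P Z ?u (\<iota> i) = g i"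
      proof (rule Hom_Gph_eqI[OF Gph.comp_in[OF D(3)[OF i] u Ai D(1) Z] gH[OF i]])
        fix x y assume x: "x \<in> vset (A i)" and y: "y \<in> vset (A i)"
        show "snd (Cmp (Gph U V) (A i) P Z ?u (\<iota> i)) x y = snd (g i) x y"
          using \<phi>\<iota>[OF \<iota>v[OF i x] \<iota>v[OF i y]] x y
          by (simp add: Cmp_Gph \<iota>v[OF i] f\<iota>[OF i] idx[OF i] pt[OF i])
      qed (simp add: Cmp_Gph \<iota>v[OF i] f\<iota>[OF i])
    next
      fix w assume w': "w \<in> Hom (Gph U V) P Z \<and> (\<forall>i\<in>I. Cmp (Gph U V) (A i) P Z w (\<iota> i) = g i)"
      then have w: "w \<in> Hom (Gph U V) P Z" by blast
      have wv: "fst w (fst (\<iota> i) x) = fst (g i) x" if "i \<in> I" "x \<in> vset (A i)" for i x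
        using w' Cmp_Gph(1)[OF that(2)] that(1) by metis
      have wf: "fst w p = f p" if "p \<in> vset P" for p
        using wv[OF ip(1)[OF that] ip(2)[OF that]] ip(3)[OF that] by (simp add: f_def)
      show "w = ?u"
      proof (rule Hom_Gph_eqI[OF w u])
        fix p q assume pq: "p \<in> vset P" "q \<in> vset P"
        have wH: "snd w p q \<in> Hom V (edge P p q) (edge Z (f p) (f q))"
          using Hom_GphD(2)[OF w pq] wf pq by simp
        note O = PO[OF pq] ZO[OF f[OF pq(1)] f[OF pq(2)]]
        have "snd w p q = \<phi> p q"
        proof (cases "idx p = idx q")
          case True
          note i = ip(1)[OF pq(1)]
          have v: "pt p \<in> vset (A (idx p))" "pt q \<in> vset (A (idx p))"
            using ip(2)[OF pq(1)] ip(2)[OF pq(2)] True by simp_all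
          have eq: "fst (\<iota> (idx p)) (pt p) = p" "fst (\<iota> (idx p)) (pt q) = q"
            using ip(3)[OF pq(1)] ip(3)[OF pq(2)] True by simp_all
          have "Cmp (Gph U V) (A (idx p)) P Z w (\<iota> (idx p)) = g (idx p)" using w' i by blast
          from arg_cong[OF this, of "\<lambda>k. snd k (pt p) (pt q)"]
          have "Cmp V (edge (A (idx p)) (pt p) (pt q)) (edge P p q) (edge Z (f p) (f q)) (snd w p q) (snd (\<iota> (idx p)) (pt p) (pt q))
              = snd (g (idx p)) (pt p) (pt q)"
            using v pq by (simp add: Cmp_Gph eq wf)
          then show ?thesis
            using iso_cancel_right[OF emb(2)[OF i v, unfolded eq] wH \<phi>[OF pq] O(2) AO[OF i v] O(1)] \<phi>\<iota>[OF pq True]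
            by simp
        next
          case False
          have "initial_object V (edge P p q)"
            using D(6)[OF ip(1)[OF pq(1)] ip(1)[OF pq(2)] ip(2)[OF pq(1)] ip(2)[OF pq(2)] False] ip(3) pq by simp
          then show ?thesis using O(2) wH \<phi>[OF pq] unfolding initial_object_def by blast
        qed
        then show "snd w p q = snd ?u p q" using pq by simp
      qed (simp add: wf)
    qed
  qed
  then show ?thesis unfolding is_coproduct_def using D(1,3) by blast
qed

text \<open>Since the dependent sum of the vertex sets is \<open>U\<close>-sized, some member
  \<open>w\<close> of \<open>U\<close> is in bijection with it and can serve as the vertex set;
  \<open>c\<close> encodes tagged vertices and \<open>b\<close> decodes them.\<close>

lemma disjoint_cocone_exists:
  assumes I: "sized U I" and A: "A \<in> I \<rightarrow> Obj (Gph U V)"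
  obtains P \<iota> where "disjoint_cocone I A P \<iota>"
proof -
  have AO: "A i \<in> Obj (Gph U V)" if "i \<in> I" for i using A that by blast
  have "sized U (SIGMA i:I. vset (A i))"
    using sized_Sigma[OF U I] sized_elts Obj_GphD(1)[OF AO] by metis
  then obtain w b where w: "w \<in> elts U" and b: "bij_betw b (elts w) (SIGMA i:I. vset (A i))"
    unfolding sized_def by blast
  define c where "c = inv_into (elts w) b"
  have c: "c (i, x) \<in> elts w" "b (c (i, x)) = (i, x)" if "i \<in> I" "x \<in> vset (A i)" for i x
    using b that unfolding c_def by (auto simp: bij_betw_inv_into_right intro: bij_betwE[OF bij_betw_inv_into[OF b], rule_format])
  have cb: "fst (b p) \<in> I" "snd (b p) \<in> vset (A (fst (b p)))" "c (fst (b p), snd (b p)) = p"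
    if "p \<in> elts w" for p
    using bij_betwE[OF b, rule_format, OF that] bij_betw_inv_into_left[OF b that] unfolding c_def by auto
  \<comment> \<open>Edge objects are copied inside a component, so that the coprojections can have
    identities as edges, and set to \<open>z\<close> across components.\<close>
  define E where "E p q = (if fst (b p) = fst (b q) then edge (A (fst (b p))) (snd (b p)) (snd (b q)) else z)" for p q
  define P where "P = \<lparr>verts = w, edge = \<lambda>p\<in>elts w. \<lambda>q\<in>elts w. E p q\<rparr>"
  define \<iota> where "\<iota> i = (\<lambda>x\<in>vset (A i). c (i, x), \<lambda>x\<in>vset (A i). \<lambda>y\<in>vset (A i). Ident V (edge (A i) x y))" for i
  have EO: "E p q \<in> Obj V" if "p \<in> elts w" "q \<in> elts w" for p q
  proof (cases "fst (b p) = fst (b q)")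
    case True
    then show ?thesis
      using Obj_GphD(2)[OF AO[OF cb(1)[OF that(1)]] cb(2)[OF that(1)], of "snd (b q)"] cb(2)[OF that(2)]
      by (simp add: E_def)
  qed (simp add: E_def z_Obj)
  have P: "P \<in> Obj (Gph U V)"
    unfolding Gph_def small_vgraphs_def using w EO by (auto simp: P_def)
  have edge: "edge P (c (i, x)) (c (i, y)) = edge (A i) x y" if "i \<in> I" "x \<in> vset (A i)" "y \<in> vset (A i)" for i x y
    using c that by (simp add: P_def E_def)
  have "full_embedding (A i) P (\<iota> i)" if i: "i \<in> I" for i
  proof -
    have idt: "is_iso V (edge (A i) x y) (edge (A i) x y) (Ident V (edge (A i) x y))"
      if "x \<in> vset (A i)" "y \<in> vset (A i)" for x y
      unfolding is_iso_def using Obj_GphD(2)[OF AO[OF i] that] Ident_in_Hom Cmp_Ident_left by blast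
    have "\<iota> i \<in> Hom (Gph U V) (A i) P"
      unfolding \<iota>_def
      by (rule Hom_GphI) (use c i in \<open>auto simp: P_def[THEN arg_cong, of verts] edge intro!: Ident_in_Hom Obj_GphD(2)[OF AO[OF i]]\<close>)
    moreover have "inj_on (fst (\<iota> i)) (vset (A i))"
      by (rule inj_on_inverseI[of _ "\<lambda>p. snd (b p)"]) (simp add: \<iota>_def c i)
    ultimately show ?thesis
      unfolding full_embedding_def using idt by (auto simp: \<iota>_def edge i)
  qed
  moreover have "\<exists>i\<in>I. p \<in> fst (\<iota> i) ` vset (A i)" if "p \<in> vset P" for p
  proof -
    have p: "p \<in> elts w" using that by (simp add: P_def)
    have "fst (\<iota> (fst (b p))) (snd (b p)) = p" using cb[OF p] by (simp add: \<iota>_def)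
    then show ?thesis using cb[OF p] by force
  qed
  moreover have "fst (\<iota> i) x \<noteq> fst (\<iota> j) y \<and> initial_object V (edge P (fst (\<iota> i) x) (fst (\<iota> j) y))"
    if "i \<in> I" "j \<in> I" "x \<in> vset (A i)" "y \<in> vset (A j)" "i \<noteq> j" for i j x y
  proof -
    have "c (i, x) \<noteq> c (j, y)" using c that by (metis prod.inject)
    then show ?thesis using c that z_initial by (simp add: \<iota>_def P_def E_def)
  qed
  ultimately have "disjoint_cocone I A P \<iota>" unfolding disjoint_cocone_def using P by blast
  then show ?thesis using that by blast
qed

text \<open>An arbitrary coproduct is isomorphic, compatibly with coprojections, to the constructed
  disjoint union, and each clause of the description passes along that isomorphism.\<close>

lemma coproduct_is_disjoint_cocone:
  assumes I: "sized U I" and A: "A \<in> I \<rightarrow> Obj (Gph U V)" and Q: "is_coproduct (Gph U V) I A (Q, \<kappa>)"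
  shows "disjoint_cocone I A Q \<kappa>"
proof -
  obtain P \<iota> where dc: "disjoint_cocone I A P \<iota>" using disjoint_cocone_exists[OF I A] .
  note D = disjoint_coconeD[OF dc] and QO = is_coproductD(1)[OF Q]
  obtain e where e: "is_iso (Gph U V) P Q e"
    and eq: "\<And>i. i \<in> I \<Longrightarrow> Cmp (Gph U V) (A i) P Q e (\<iota> i) = \<kappa> i"
    by (rule Gph.coproducts_iso[OF disjoint_cocone_is_coproduct[OF dc A] Q A]) blast
  note E = iso_full_embedding[OF e D(1) QO]
  have inj: "inj_on (fst e) (vset P)" and iso: "\<And>p q. p \<in> vset P \<Longrightarrow> q \<in> vset P \<Longrightarrow>
      is_iso V (edge P p q) (edge Q (fst e p) (fst e q)) (snd e p q)"
    and eH: "e \<in> Hom (Gph U V) P Q"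
    using E(1) unfolding full_embedding_def by blast+
  have \<iota>v: "fst (\<iota> i) x \<in> vset P" if "i \<in> I" "x \<in> vset (A i)" for i x
    using Hom_GphD(1)[OF D(3)] that by blast
  have \<kappa>: "fst (\<kappa> i) x = fst e (fst (\<iota> i) x)" if "i \<in> I" "x \<in> vset (A i)" for i x
    using eq[OF that(1)] Cmp_Gph(1)[OF that(2)] by metis
  have "full_embedding (A i) Q (\<kappa> i)" if "i \<in> I" for i
    using full_embedding_comp[OF D(2)[OF that] E(1) _ D(1) QO] A eq[OF that] that by auto
  moreover have "\<exists>i\<in>I. q \<in> fst (\<kappa> i) ` vset (A i)" if q: "q \<in> vset Q" for q
  proof -
    obtain p where p: "p \<in> vset P" "q = fst e p" using q E(2) by (metis imageE)
    obtain i x where "i \<in> I" "x \<in> vset (A i)" "fst (\<iota> i) x = p" using D(4)[OF p(1)] by blast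
    then show ?thesis using \<kappa> p(2) by force
  qed
  moreover have "fst (\<kappa> i) x \<noteq> fst (\<kappa> j) y \<and> initial_object V (edge Q (fst (\<kappa> i) x) (fst (\<kappa> j) y))"
    if ij: "i \<in> I" "j \<in> I" "x \<in> vset (A i)" "y \<in> vset (A j)" "i \<noteq> j" for i j x y
  proof -
    note v = \<iota>v[OF ij(1,3)] \<iota>v[OF ij(2,4)]
    \<comment> \<open>The inverse edge map points from \<open>Q\<close> back to the initial edge
      object of \<open>P\<close>, so strictness transfers initiality.\<close>
    obtain d where "d \<in> Hom V (edge Q (fst (\<kappa> i) x) (fst (\<kappa> j) y)) (edge P (fst (\<iota> i) x) (fst (\<iota> j) y))"
      using iso[OF v] unfolding \<kappa>[OF ij(1,3)] \<kappa>[OF ij(2,4)] by (rule is_isoE)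
    then have "initial_object V (edge Q (fst (\<kappa> i) x) (fst (\<kappa> j) y))"
      using initial_object_strict[OF D(6)[OF ij]] Obj_GphD(2)[OF QO] Hom_GphD(1)[OF eH] v
      by (simp add: \<kappa> ij)
    moreover have "fst (\<kappa> i) x \<noteq> fst (\<kappa> j) y"
      using D(5)[OF ij(1-4)] ij(5) inj_onD[OF inj _ v] \<kappa>[OF ij(1,3)] \<kappa>[OF ij(2,4)] by auto
    ultimately show ?thesis by blast
  qed
  ultimately show ?thesis unfolding disjoint_cocone_def using QO by blast
qed

section \<open>Cartesian coprojections and decomposition over a coproduct\<close>

text \<open>If \<open>a\<close> sends a vertex into component \<open>j\<close>, then
  \<open>u\<close> sends it on into component \<open>j\<close> of \<open>Q\<close>; by commutativity
  it also lies in component \<open>i\<close>, so \<open>j = i\<close>. Hence \<open>a\<close>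
  factors through the full embedding \<iota> i, uniquely since that is monic.\<close>

lemma cartesian_Gph:
  assumes I: "sized U I" and A: "A \<in> I \<rightarrow> Obj (Gph U V)" and X: "X \<in> I \<rightarrow> Obj (Gph U V)"
  shows "cartesian_coprojections (Gph U V) I A X"
  unfolding cartesian_coprojections_def
proof (intro allI impI ballI)
  fix P \<iota> Q \<kappa> f u i T a b
  assume P: "is_coproduct (Gph U V) I A (P, \<iota>)" and Q: "is_coproduct (Gph U V) I X (Q, \<kappa>)"
    and f: "\<forall>i\<in>I. f i \<in> Hom (Gph U V) (A i) (X i)" and u: "u \<in> Hom (Gph U V) P Q"
    and u\<iota>: "\<forall>i\<in>I. Cmp (Gph U V) (A i) P Q u (\<iota> i) = Cmp (Gph U V) (A i) (X i) Q (\<kappa> i) (f i)"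
    and i: "i \<in> I" and T: "T \<in> Obj (Gph U V)"
    and a: "a \<in> Hom (Gph U V) T P" and b: "b \<in> Hom (Gph U V) T (X i)"
    and ab: "Cmp (Gph U V) T P Q u a = Cmp (Gph U V) T (X i) Q (\<kappa> i) b"
  note DP = disjoint_coconeD[OF coproduct_is_disjoint_cocone[OF I A P]]
  note DQ = disjoint_coconeD[OF coproduct_is_disjoint_cocone[OF I X Q]]
  have Ai: "A i \<in> Obj (Gph U V)" and Xi: "X i \<in> Obj (Gph U V)" using A X i by auto
  have fi: "f i \<in> Hom (Gph U V) (A i) (X i)" using f i by blast
  have "fst a ` vset T \<subseteq> fst (\<iota> i) ` vset (A i)"
  proof clarify
    fix t assume t: "t \<in> vset T"
    obtain j x where jx: "j \<in> I" "x \<in> vset (A j)" "fst (\<iota> j) x = fst a t"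
      using DP(4)[OF Hom_GphD(1)[OF a t]] by blast
    have "fst u (fst a t) = fst (\<kappa> i) (fst b t)"
      using arg_cong[OF ab, of "\<lambda>k. fst k t"] t by (simp add: Cmp_Gph)
    moreover have "fst u (fst (\<iota> j) x) = fst (\<kappa> j) (fst (f j) x)"
      using arg_cong[OF bspec[OF u\<iota> jx(1)], of "\<lambda>k. fst k x"] jx(2) by (simp add: Cmp_Gph)
    ultimately have "fst (\<kappa> j) (fst (f j) x) = fst (\<kappa> i) (fst b t)" using jx(3) by simp
    then have "j = i"
      by (rule DQ(5)[OF jx(1) i Hom_GphD(1)[OF bspec[OF f jx(1)] jx(2)] Hom_GphD(1)[OF b t]])
    then show "fst a t \<in> fst (\<iota> i) ` vset (A i)" using jx(2,3) by (metis imageI)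
  qed
  then obtain c where c: "c \<in> Hom (Gph U V) T (A i)" and \<iota>c: "Cmp (Gph U V) T (A i) P (\<iota> i) c = a"
    using full_embedding_factor[OF DP(2)[OF i] T Ai DP(1) a] by blast
  \<comment> \<open>The second triangle is verified after composing with \<kappa> i, which is monic
    as a full embedding.\<close>
  have "Cmp (Gph U V) T (X i) Q (\<kappa> i) (Cmp (Gph U V) T (A i) (X i) (f i) c)
      = Cmp (Gph U V) T (A i) Q (Cmp (Gph U V) (A i) (X i) Q (\<kappa> i) (f i)) c"
    by (rule Gph.Cmp_assoc[OF T Ai Xi DQ(1) c fi DQ(3)[OF i]])
  also have "\<dots> = Cmp (Gph U V) T (A i) Q (Cmp (Gph U V) (A i) P Q u (\<iota> i)) c"
    using u\<iota> i by simp
  also have "\<dots> = Cmp (Gph U V) T (X i) Q (\<kappa> i) b"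
    using Gph.Cmp_assoc[OF T Ai DP(1) DQ(1) c DP(3)[OF i] u] \<iota>c ab by simp
  finally have "Cmp (Gph U V) T (A i) (X i) (f i) c = b"
    by (rule full_embedding_monic[OF DQ(2)[OF i] T Xi DQ(1) Gph.comp_in[OF c fi T Ai Xi] b])
  then show "\<exists>!c. c \<in> Hom (Gph U V) T (A i) \<and> Cmp (Gph U V) T (A i) P (\<iota> i) c = a
      \<and> Cmp (Gph U V) T (A i) (X i) (f i) c = b"
    using c \<iota>c full_embedding_monic[OF DP(2)[OF i] T Ai DP(1)] by blast
qed

text \<open>Take for \<open>A i\<close> the full subgraph of \<open>Y\<close> on the vertices that
  \<open>h\<close> sends into the i-th summand. These subgraphs cover \<open>Y\<close> and are
  disjoint because the summands of \<open>Q\<close> are.\<close>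

lemma coproduct_decomposition_Gph:
  assumes dc: "disjoint_cocone I X Q \<kappa>" and X: "X \<in> I \<rightarrow> Obj (Gph U V)"
    and Y: "Y \<in> Obj (Gph U V)" and h: "h \<in> Hom (Gph U V) Y Q"
  obtains A j f where "A \<in> I \<rightarrow>\<^sub>E Obj (Gph U V)" "disjoint_cocone I A Y j"
    "\<And>i. i \<in> I \<Longrightarrow> f i \<in> Hom (Gph U V) (A i) (X i)"
    "\<And>i. i \<in> I \<Longrightarrow> Cmp (Gph U V) (A i) Y Q h (j i) = Cmp (Gph U V) (A i) (X i) Q (\<kappa> i) (f i)"
proof -
  note D = disjoint_coconeD[OF dc]
  \<comment> \<open>The preimage of a summand is a member of \<open>U\<close> as a subset of the
    vertex set of \<open>Y\<close>.\<close>
  have "\<forall>i. \<exists>w. w \<in> elts U \<and> elts w = {y \<in> vset Y. fst h y \<in> fst (\<kappa> i) ` vset (X i)}"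
    using universe_subset[OF U Obj_GphD(1)[OF Y]] by (metis (no_types, lifting) mem_Collect_eq subsetI)
  then obtain w where w: "\<And>i. w i \<in> elts U"
    and ew: "\<And>i. elts (w i) = {y \<in> vset Y. fst h y \<in> fst (\<kappa> i) ` vset (X i)}"
    by metis
  define A where "A = (\<lambda>i\<in>I. \<lparr>verts = w i, edge = \<lambda>x\<in>elts (w i). \<lambda>y\<in>elts (w i). edge Y x y\<rparr>)"
  define j where "j i = (\<lambda>x\<in>elts (w i). x, \<lambda>x\<in>elts (w i). \<lambda>y\<in>elts (w i). Ident V (edge Y x y))" for i
  have A: "verts (A i) = w i" "\<And>x y. x \<in> elts (w i) \<Longrightarrow> y \<in> elts (w i) \<Longrightarrow> edge (A i) x y = edge Y x y"
    if "i \<in> I" for i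
    using that by (simp_all add: A_def)
  have wY: "x \<in> vset Y" if "x \<in> elts (w i)" for x i using that ew by blast
  note YO = Obj_GphD(2)[OF Y]
  have AE: "A \<in> I \<rightarrow>\<^sub>E Obj (Gph U V)"
    unfolding A_def Gph_def small_vgraphs_def using w YO wY by auto
  then have AO: "A i \<in> Obj (Gph U V)" if "i \<in> I" for i using that by blast
  have jE: "full_embedding (A i) Y (j i)" if i: "i \<in> I" for i
  proof -
    have "j i \<in> Hom (Gph U V) (A i) Y"
      unfolding j_def A(1)[OF i, symmetric]
      by (rule Hom_GphI) (auto simp: A[OF i] intro: wY intro!: Ident_in_Hom YO)
    moreover have "is_iso V (edge Y x y) (edge Y x y) (Ident V (edge Y x y))"
      if "x \<in> elts (w i)" "y \<in> elts (w i)" for x y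
      unfolding is_iso_def using YO[OF wY[OF that(1)] wY[OF that(2)]] Ident_in_Hom Cmp_Ident_left by blast
    ultimately show ?thesis
      unfolding full_embedding_def by (auto simp: A[OF i] j_def inj_on_def)
  qed
  have jH: "j i \<in> Hom (Gph U V) (A i) Y" if "i \<in> I" for i
    using jE[OF that] by (simp add: full_embedding_def)
  have jv: "fst (j i) x = x" if "x \<in> elts (w i)" for i x using that by (simp add: j_def)
  have same: "i = k" if ik: "i \<in> I" "k \<in> I" "x \<in> elts (w i)" "x \<in> elts (w k)" for i k x
  proof -
    obtain s t where "s \<in> vset (X i)" "fst h x = fst (\<kappa> i) s" "t \<in> vset (X k)" "fst h x = fst (\<kappa> k) t"
      using ik(3,4) unfolding ew by blast
    then show ?thesis using D(5)[OF ik(1,2)] by metis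
  qed
  have "\<exists>i\<in>I. y \<in> fst (j i) ` vset (A i)" if y: "y \<in> vset Y" for y
  proof -
    obtain i x where i: "i \<in> I" "x \<in> vset (X i)" "fst (\<kappa> i) x = fst h y"
      using D(4)[OF Hom_GphD(1)[OF h y]] by blast
    then have "y \<in> elts (w i)" using y unfolding ew by force
    then show ?thesis using i(1) jv A(1) by force
  qed
  moreover have "fst (j i) x \<noteq> fst (j k) y \<and> initial_object V (edge Y (fst (j i) x) (fst (j k) y))"
    if ik: "i \<in> I" "k \<in> I" "x \<in> vset (A i)" "y \<in> vset (A k)" "i \<noteq> k" for i k x y
  proof -
    have x: "x \<in> elts (w i)" and y: "y \<in> elts (w k)" using ik A(1) by auto
    obtain s t where st: "s \<in> vset (X i)" "fst h x = fst (\<kappa> i) s" "t \<in> vset (X k)" "fst h y = fst (\<kappa> k) t"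
      using x y unfolding ew by blast
    have "initial_object V (edge Q (fst h x) (fst h y))"
      using D(6)[OF ik(1,2) st(1,3) ik(5)] st by simp
    \<comment> \<open>The edge component of \<open>h\<close> at \<open>x\<close>, \<open>y\<close>
      is an arrow into an initial object: here strictness is essential.\<close>
    then have "initial_object V (edge Y x y)"
      using initial_object_strict Hom_GphD(2)[OF h wY[OF x] wY[OF y]] YO[OF wY[OF x] wY[OF y]] by blast
    moreover have "x \<noteq> y" using same[OF ik(1,2) x] y ik(5) by blast
    ultimately show ?thesis using jv[OF x] jv[OF y] by simp
  qed
  ultimately have dj: "disjoint_cocone I A Y j" unfolding disjoint_cocone_def using Y jE by blast
  \<comment> \<open>By the choice of \<open>w i\<close>, the restriction of \<open>h\<close> to
    \<open>A i\<close> meets only vertices in the image of \<kappa> i, so it factors through that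
    full embedding.\<close>
  have "\<exists>f. f \<in> Hom (Gph U V) (A i) (X i) \<and>
      Cmp (Gph U V) (A i) Y Q h (j i) = Cmp (Gph U V) (A i) (X i) Q (\<kappa> i) f" if i: "i \<in> I" for i
  proof -
    have "fst (Cmp (Gph U V) (A i) Y Q h (j i)) ` vset (A i) \<subseteq> fst (\<kappa> i) ` vset (X i)"
    proof clarify
      fix x assume x: "x \<in> vset (A i)"
      then have xw: "x \<in> elts (w i)" using A(1)[OF i] by simp
      then show "fst (Cmp (Gph U V) (A i) Y Q h (j i)) x \<in> fst (\<kappa> i) ` vset (X i)"
        unfolding Cmp_Gph(1)[OF x] jv[OF xw] using ew by blast
    qed
    moreover have "X i \<in> Obj (Gph U V)" using X i by blast
    ultimately show ?thesis
      using full_embedding_factor[OF D(2)[OF i] AO[OF i] _ D(1) Gph.comp_in[OF jH[OF i] h AO[OF i] Y D(1)]]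
      by metis
  qed
  then obtain f where "\<And>i. i \<in> I \<Longrightarrow> f i \<in> Hom (Gph U V) (A i) (X i)"
    "\<And>i. i \<in> I \<Longrightarrow> Cmp (Gph U V) (A i) Y Q h (j i) = Cmp (Gph U V) (A i) (X i) Q (\<kappa> i) (f i)"
    by metis
  then show ?thesis by (rule that[OF AE dj])
qed

lemma coproduct_functor_Gph_equivalence:
  assumes I: "sized U I" and S: "coproduct_choice (Gph U V) I S" and X: "X \<in> I \<rightarrow>\<^sub>E Obj (Gph U V)"
  shows "is_equivalence (product_category I (\<lambda>i. slice (Gph U V) (X i)))
    (slice (Gph U V) (fst (S X))) (coproduct_functor (Gph U V) I S X)"
proof (rule coproduct_functor_equivalence[OF Gph.category_axioms S X])
  have X': "X \<in> I \<rightarrow> Obj (Gph U V)" using X by auto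
  show "cartesian_coprojections (Gph U V) I A X" if "A \<in> I \<rightarrow>\<^sub>E Obj (Gph U V)" for A
    using cartesian_Gph[OF I _ X'] that by auto
  fix Y h assume Y: "Y \<in> Obj (Gph U V)" and h: "h \<in> Hom (Gph U V) Y (fst (S X))"
  have "is_coproduct (Gph U V) I X (fst (S X), snd (S X))"
    using S X unfolding coproduct_choice_def by simp
  then have dc: "disjoint_cocone I X (fst (S X)) (snd (S X))"
    by (rule coproduct_is_disjoint_cocone[OF I X'])
  obtain A j f where A: "A \<in> I \<rightarrow>\<^sub>E Obj (Gph U V)" and dj: "disjoint_cocone I A Y j"
    and f: "\<And>i. i \<in> I \<Longrightarrow> f i \<in> Hom (Gph U V) (A i) (X i)"
      "\<And>i. i \<in> I \<Longrightarrow> Cmp (Gph U V) (A i) Y (fst (S X)) h (j i)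
        = Cmp (Gph U V) (A i) (X i) (fst (S X)) (snd (S X) i) (f i)"
    by (rule coproduct_decomposition_Gph[OF dc X' Y h]) blast
  have "is_coproduct (Gph U V) I A (Y, j)"
    using A by (intro disjoint_cocone_is_coproduct[OF dj]) auto
  then show "\<exists>A j f. A \<in> I \<rightarrow>\<^sub>E Obj (Gph U V) \<and> is_coproduct (Gph U V) I A (Y, j) \<and>
      (\<forall>i\<in>I. f i \<in> Hom (Gph U V) (A i) (X i) \<and> Cmp (Gph U V) (A i) Y (fst (S X)) h (j i)
        = Cmp (Gph U V) (A i) (X i) (fst (S X)) (snd (S X) i) (f i))"
    using A f by blast
qed

end

section \<open>Size of the category of graphs, and conclusion\<close>

text \<open>As a member of \<open>U2\<close>, the universe \<open>U1\<close> bounds the collection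
  of all vertex sets, and by transitivity each vertex set is \<open>U2\<close>-sized as well; graphs
  and arrows are then dependent pairs of functions.\<close>

lemma large_category_Gph:
  assumes U1: "universe U1" and U2: "universe U2" and mem: "U1 \<in> elts U2" and V: "large_category U2 V"
  shows "large_category U2 (Gph U1 V)"
  unfolding large_category_def
proof (intro conjI ballI)
  have "category V" and VO: "sized U2 (Obj V)"
    and VH: "\<And>x y. x \<in> Obj V \<Longrightarrow> y \<in> Obj V \<Longrightarrow> sized U2 (Hom V x y)"
    using V unfolding large_category_def by blast+
  show "category (Gph U1 V)" by (rule category_Gph) fact
  have el: "sized U2 (elts w)" if "w \<in> elts U1" for w
    using that universe_trans[OF U2 mem] by (intro sized_elts) blast
  show "sized U2 (Obj (Gph U1 V))"
  proof (rule sized_inj_on[OF U2])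
    show "sized U2 (SIGMA w:elts U1. elts w \<rightarrow>\<^sub>E elts w \<rightarrow>\<^sub>E Obj V)"
      by (intro sized_Sigma sized_PiE U2 sized_elts[OF mem] el VO)
    show "inj_on (\<lambda>G. (verts G, edge G)) (Obj (Gph U1 V))" by (auto simp: inj_on_def)
    show "(\<lambda>G. (verts G, edge G)) ` Obj (Gph U1 V) \<subseteq> (SIGMA w:elts U1. elts w \<rightarrow>\<^sub>E elts w \<rightarrow>\<^sub>E Obj V)"
      by (auto simp: Gph_def small_vgraphs_def)
  qed
  fix G H assume G: "G \<in> Obj (Gph U1 V)" and H: "H \<in> Obj (Gph U1 V)"
  show "sized U2 (Hom (Gph U1 V) G H)"
  proof (rule sized_subset[OF U2])
    \<comment> \<open>A dependent sum is needed because the codomains of the edge components vary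
      with the vertex map \<open>f\<close>.\<close>
    show "sized U2 (SIGMA f:vset G \<rightarrow>\<^sub>E vset H.
        \<Pi>\<^sub>E x\<in>vset G. \<Pi>\<^sub>E y\<in>vset G. Hom V (edge G x y) (edge H (f x) (f y)))"
      by (intro sized_Sigma sized_PiE U2 el VH Obj_GphD[OF G] Obj_GphD[OF H]) auto
  qed (auto simp: Gph_def vgraph_hom_def)
qed

theorem proposition6p5:
  fixes U1 U2 :: "'v::set_domain"
    and V :: "('o, 'a) cat"
    and z :: 'o
  assumes "universe U1" and "universe U2" and "U1 \<in> elts U2"
    and "large_category U2 V"
    and "strict_initial_object V z"
  shows "extensive U1 U2 (Gph U1 V)"
proof -
  \<comment> \<open>With \<open>U1\<close> as \<open>U\<close>, index sets and vertex sets are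
    bounded by the same universe, so disjoint unions of small families stay small.\<close>
  interpret vgraphs V U1 z
    using assms unfolding vgraphs_def vgraphs_axioms_def large_category_def by blast
  have "\<exists>p. is_coproduct (Gph U1 V) (elts J) X p"
    if J: "J \<in> elts U1" and XE: "X \<in> elts J \<rightarrow>\<^sub>E Obj (Gph U1 V)" for J X
  proof -
    have X: "X \<in> elts J \<rightarrow> Obj (Gph U1 V)" using XE by auto
    obtain P \<iota> where "disjoint_cocone (elts J) X P \<iota>"
      using disjoint_cocone_exists[OF sized_elts[OF J] X] .
    then show ?thesis using disjoint_cocone_is_coproduct X by blast
  qed
  then show ?thesis
    unfolding extensive_def
    using large_category_Gph[OF assms(1-4)] coproduct_functor_Gph_equivalence sized_elts by blast
qed

end
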